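(* Let $N\geq 1$ and write points of $\mathbb{R}^N$ as $(x,y)$ with $x\in\mathbb{R}$, $y\in\mathbb{R}^{N-1}$. Let $(U,V)$ be the one-dimensional profile fixed in the context. If $P,Q\in C^2(\mathbb{R}^N)\cap L^\infty(\mathbb{R}^N)$ satisfy $$ \left\{\begin{array}{l} -\Delta P+V^2(x)P+2U(x)V(x)Q=0,\\ -\Delta Q+U^2(x)Q+2U(x)V(x)P=0, \end{array}\right.\qquad (x,y)\in\mathbb{R}\times\mathbb{R}^{N-1}, $$ then $P$ and $Q$ depend only on $x$, and there is a constant $a\in\mathbb{R}$ such that $$ (P,Q)(x,y)=a\left(U'(x),V'(x)\right)\quad\text{for all }(x,y)\in\mathbb{R}\times\mathbb{R}^{N-1}. $$
   Context: $\Delta$ is the Laplacian in all $N$ variables $(x,y)$. The pair $(U,V)$ denotes the fixed solution of $$-U''+V^2U=0,\qquad -V''+U^2V=0,\qquad U,V>0\ \text{ in }\mathbb{R},$$ satisfying the reflection symmetry $U(-x)=V(x)$ for all $x\in\mathbb{R}$ and $U(x)\to 0$ as $x\to-\infty$, $U'(x)\to 1$ as $x\to+\infty$. It is known that all solutions of this ODE system are, for this $(U,V)$, of the form $(\mu U(\mu x+\xi),\mu V(\mu x+\xi))$ with $\mu>0$, $\xi\in\mathbb{R}$; that the convergences in the two limits above are super-exponentially fast; and that $U$ is strictly increasing and convex. *)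

theory Defs
  imports "HOL-Analysis.Analysis"
begin

definition partial :: "'n::finite \<Rightarrow> (real ^ 'n \<Rightarrow> real) \<Rightarrow> real ^ 'n \<Rightarrow> real" where
  "partial i f z = deriv (\<lambda>t. f (z + t *\<^sub>R axis i 1)) 0"

(* The differentiability clause is needed because deriv is total: it has an
   unspecified value where the derivative does not exist. *)
primrec C_k :: "nat \<Rightarrow> (real ^ 'n::finite \<Rightarrow> real) \<Rightarrow> bool" where
  "C_k 0 f \<longleftrightarrow> continuous_on UNIV f"
| "C_k (Suc m) f \<longleftrightarrow> continuous_on UNIV f \<and>
     (\<forall>i. (\<forall>z. (\<lambda>t. f (z + t *\<^sub>R axis i 1)) differentiable at 0) \<and> C_k m (partial i f))"

definition laplacian :: "(real ^ 'n::finite \<Rightarrow> real) \<Rightarrow> real ^ 'n \<Rightarrow> real" where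
  "laplacian f z = (\<Sum>i\<in>UNIV. partial i (partial i f) z)"

definition L_infty :: "(real ^ 'n::finite \<Rightarrow> real) \<Rightarrow> bool" where
  "L_infty f \<longleftrightarrow> f \<in> borel_measurable lebesgue \<and> (\<exists>C. AE z in lebesgue. \<bar>f z\<bar> \<le> C)"

(* The positive solution of - U'' + V^2 U = 0, - V'' + U^2 V = 0 on the line,
   normalised by U(- x) = V(x), U(- infinity) = 0 and U'(+ infinity) = 1.
   Monotonicity, convexity, decay rates and the classification of all solutions
   are consequences of these conditions and are not part of the definition. *)
definition profile :: "(real \<Rightarrow> real) \<Rightarrow> (real \<Rightarrow> real) \<Rightarrow> bool" where
  "profile U V \<longleftrightarrow>
     (\<forall>x. U differentiable at x \<and> deriv U differentiable at x) \<and>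
     (\<forall>x. V differentiable at x \<and> deriv V differentiable at x) \<and>
     (\<forall>x. - deriv (deriv U) x + (V x)\<^sup>2 * U x = 0) \<and>
     (\<forall>x. - deriv (deriv V) x + (U x)\<^sup>2 * V x = 0) \<and>
     (\<forall>x. U x > 0 \<and> V x > 0) \<and>
     (\<forall>x. U (- x) = V x) \<and>
     (U \<longlongrightarrow> 0) at_bot \<and>
     (deriv U \<longlongrightarrow> 1) at_top"

end

theory Submission
  imports Defs
begin

text \<open>
  Put \<open>\<phi> = P\<close> and \<open>\<psi> = - Q\<close>. The system becomes cooperative,
  \<open>\<Delta>\<phi> = V\<^sup>2 \<phi> - 2 U V \<psi>\<close> and \<open>\<Delta>\<psi> = U\<^sup>2 \<psi> - 2 U V \<phi>\<close>, and differentiating the equations of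
  the profile shows that \<open>(p, q) = (U', - V')\<close> is a solution of it that depends on \<open>x\<close> only; both of
  its components are positive. A cooperative system with a positive solution obeys maximum
  principles: divide the two components by \<open>p\<close> and \<open>q\<close>; where the smaller of the two ratios has a
  minimum, the zeroth-order terms have a favourable sign (\<open>ratio_touching\<close>).

  The proof has three parts.

  \<^item> A bounded solution satisfies \<open>\<bar>\<phi>\<bar> \<le> M p\<close> and \<open>\<bar>\<psi>\<bar> \<le> M q\<close> (\<open>bounded_solution_le_profile\<close>). Where
    \<open>p\<close> is not bounded below, namely for \<open>x < 0\<close>, the coefficient \<open>V\<^sup>2\<close> is bounded below by
    \<open>V(0)\<^sup>2 > 0\<close>, and the scalar maximum principle on the half-space applies to \<open>M p - \<phi>\<close>.

  \<^item> A bounded solution is invariant under every reflection in a hyperplane \<open>y\<^sub>e = c\<close> that is parallel to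
    the \<open>x\<close>-axis, which forces it to depend on \<open>x\<close> only. The difference of the solution and its
    reflection is again a solution, vanishes for \<open>t = y\<^sub>e - c = 0\<close> and is at most \<open>M (p, q)\<close>. Since \<open>t\<close> is
    harmonic and does not involve \<open>x\<close>, also \<open>t (p, q)\<close> is a solution, and the maximum principle on the
    slab \<open>0 \<le> t \<le> L\<close> bounds the difference by \<open>M (t / L) (p, q)\<close> (\<open>slab_comparison\<close>). Letting \<open>L\<close> tend
    to infinity shows that it is nonpositive for \<open>t \<ge> 0\<close>; the same holds for its negative. This is
    the reflection proof of Liouville's theorem, and it works in every dimension. The slab is unbounded
    in the other directions, which the barrier \<open>\<bar>z\<bar>\<^sup>2 + A (L\<^sup>2 - t\<^sup>2)\<close> takes care of: with the weights
    \<open>p\<close> and \<open>q\<close> it is a strict supersolution as soon as \<open>x p' / p\<close> and \<open>x q' / q\<close> are bounded above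
    (\<open>log_derivative_bound\<close>), a consequence of the conserved energy of the profile.

  \<^item> For a solution \<open>(f, g)\<close> of the resulting system of ordinary differential equations, the quantity
    \<open>E = p\<^sup>2 r r' + q\<^sup>2 s s'\<close> with \<open>r = f / p\<close> and \<open>s = g / q\<close> is nondecreasing. It is bounded above and
    below by derivatives of bounded functions, which is possible only if it vanishes identically. Then
    \<open>E' = 0\<close>, which says that \<open>r\<close> and \<open>s\<close> are equal and constant (\<open>one_dimensional_solution_unique\<close>).

  The maximum principles rest on one property of the Laplacian: it is a sum of second derivatives
  along the coordinate axes, each of which is nonnegative at a local minimum. This is why
  \<open>has_laplacian\<close> speaks of derivatives along the axes.
\<close>

section \<open>Laplacians computed along the coordinate axes\<close>

text \<open>
  The derivatives are recorded as functions of the base point, next to the function itself. This form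
  is closed under sums, products and reflections by the one-variable rules for derivatives.
\<close>

definition axis_derivs ::
    "(real ^ 'n::finite \<Rightarrow> real) \<Rightarrow> ('n \<Rightarrow> real ^ 'n \<Rightarrow> real) \<Rightarrow> ('n \<Rightarrow> real ^ 'n \<Rightarrow> real) \<Rightarrow> bool" where
  "axis_derivs f f1 f2 \<longleftrightarrow>
     (\<forall>i z. ((\<lambda>t. f (z + t *\<^sub>R axis i 1)) has_real_derivative f1 i z) (at 0)) \<and>
     (\<forall>i z. ((\<lambda>t. f1 i (z + t *\<^sub>R axis i 1)) has_real_derivative f2 i z) (at 0))"

definition has_laplacian :: "(real ^ 'n::finite \<Rightarrow> real) \<Rightarrow> (real ^ 'n \<Rightarrow> real) \<Rightarrow> bool" where
  "has_laplacian f l \<longleftrightarrow> (\<exists>f1 f2. axis_derivs f f1 f2 \<and> (\<forall>z. l z = (\<Sum>i\<in>UNIV. f2 i z)))"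

lemma axis_shift_nth: "(z + t *\<^sub>R axis i (1::real)) $ j = z $ j + (if j = i then t else 0)"
  by (simp add: axis_def)

lemma axis_derivs_line:
  assumes "axis_derivs f f1 f2"
  shows "((\<lambda>t. f (z + t *\<^sub>R axis i 1)) has_real_derivative f1 i (z + t *\<^sub>R axis i 1)) (at t)"
    and "((\<lambda>t. f1 i (z + t *\<^sub>R axis i 1)) has_real_derivative f2 i (z + t *\<^sub>R axis i 1)) (at t)"
proof -
  have shift: "((\<lambda>t. g (z + t *\<^sub>R axis i 1)) has_real_derivative d) (at t)"
    if "((\<lambda>s. g ((z + t *\<^sub>R axis i 1) + s *\<^sub>R axis i 1)) has_real_derivative d) (at 0)" for g d
  proof -
    have "((\<lambda>s. g (z + (s + t) *\<^sub>R axis i 1)) has_real_derivative d) (at 0)"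
      using that by (simp add: algebra_simps)
    then show ?thesis
      using DERIV_shift[of "\<lambda>t. g (z + t *\<^sub>R axis i 1)" d 0 t] by simp
  qed
  show "((\<lambda>t. f (z + t *\<^sub>R axis i 1)) has_real_derivative f1 i (z + t *\<^sub>R axis i 1)) (at t)"
    by (rule shift) (use assms in \<open>simp add: axis_derivs_def\<close>)
  show "((\<lambda>t. f1 i (z + t *\<^sub>R axis i 1)) has_real_derivative f2 i (z + t *\<^sub>R axis i 1)) (at t)"
    by (rule shift) (use assms in \<open>simp add: axis_derivs_def\<close>)
qed

lemma C_k_2_axis_derivs:
  assumes "C_k 2 f"
  shows "axis_derivs f (\<lambda>i. partial i f) (\<lambda>i. partial i (partial i f))"
  using assms
  by (auto simp: axis_derivs_def partial_def numeral_2_eq_2 DERIV_deriv_iff_real_differentiable)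

lemma C_k_2_has_laplacian: "C_k 2 f \<Longrightarrow> has_laplacian f (laplacian f)"
  unfolding has_laplacian_def laplacian_def by (blast dest: C_k_2_axis_derivs)

lemma has_laplacian_diff:
  assumes "has_laplacian f l" "has_laplacian g m"
  shows "has_laplacian (\<lambda>z. f z - g z) (\<lambda>z. l z - m z)"
proof -
  from assms obtain f1 f2 g1 g2 where
    f: "axis_derivs f f1 f2" "\<And>z. l z = (\<Sum>i\<in>UNIV. f2 i z)" and
    g: "axis_derivs g g1 g2" "\<And>z. m z = (\<Sum>i\<in>UNIV. g2 i z)"
    unfolding has_laplacian_def by blast
  have "axis_derivs (\<lambda>z. f z - g z) (\<lambda>i z. f1 i z - g1 i z) (\<lambda>i z. f2 i z - g2 i z)"
    using f(1) g(1) unfolding axis_derivs_def by (auto intro!: DERIV_diff)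
  then show ?thesis
    unfolding has_laplacian_def f(2) g(2) by (force simp: sum_subtractf)
qed

lemma has_laplacian_minus:
  assumes "has_laplacian f l"
  shows "has_laplacian (\<lambda>z. - f z) (\<lambda>z. - l z)"
proof -
  from assms obtain f1 f2 where
    f: "axis_derivs f f1 f2" "\<And>z. l z = (\<Sum>i\<in>UNIV. f2 i z)"
    unfolding has_laplacian_def by blast
  have "axis_derivs (\<lambda>z. - f z) (\<lambda>i z. - f1 i z) (\<lambda>i z. - f2 i z)"
    using f(1) unfolding axis_derivs_def by (auto intro!: DERIV_minus)
  then show ?thesis
    unfolding has_laplacian_def f(2) by (force simp: sum_negf)
qed

text \<open>
  All comparison functions below are a weight in the variable \<open>z $ k\<close> times a sum of functions of one
  coordinate each; for these the product rule produces only one mixed term.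
\<close>

lemma has_laplacian_weight_times_sum:
  fixes a a' a'' :: "real \<Rightarrow> real" and b b' b'' :: "'n::finite \<Rightarrow> real \<Rightarrow> real" and k :: 'n
  assumes a: "\<And>x. (a has_real_derivative a' x) (at x)" "\<And>x. (a' has_real_derivative a'' x) (at x)"
    and b: "\<And>i x. (b i has_real_derivative b' i x) (at x)"
           "\<And>i x. (b' i has_real_derivative b'' i x) (at x)"
  defines "B \<equiv> \<lambda>z. \<Sum>i\<in>UNIV. b i (z $ i)"
  shows "has_laplacian (\<lambda>z. a (z $ k) * B z)
    (\<lambda>z. a'' (z $ k) * B z + 2 * a' (z $ k) * b' k (z $ k) + a (z $ k) * (\<Sum>i\<in>UNIV. b'' i (z $ i)))"
proof -
  define f1 where "f1 = (\<lambda>i (z::real^'n). (if i = k then a' (z $ k) * B z else 0) + a (z $ k) * b' i (z $ i))"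
  define f2 where "f2 = (\<lambda>i (z::real^'n). (if i = k then a'' (z $ k) * B z + 2 * a' (z $ k) * b' k (z $ k) else 0)
      + a (z $ k) * b'' i (z $ i))"
  have comp: "((\<lambda>t. g (x + (if j = i then t else 0))) has_real_derivative (if j = i then d else 0)) (at 0)"
    if "(g has_real_derivative d) (at x)" for g :: "real \<Rightarrow> real" and d x and i j :: 'n
    using that DERIV_shift[of g d 0 x] by (auto simp: add.commute)
  have dB: "((\<lambda>t. B (z + t *\<^sub>R axis i 1)) has_real_derivative b' i (z $ i)) (at 0)" for i z
  proof -
    have "((\<lambda>t. \<Sum>j\<in>UNIV. b j (z $ j + (if j = i then t else 0))) has_real_derivative
        (\<Sum>j\<in>UNIV. if j = i then b' j (z $ j) else 0)) (at 0)"
      by (intro DERIV_sum comp b)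
    then show ?thesis unfolding B_def axis_shift_nth by (simp add: sum.delta)
  qed
  have da: "((\<lambda>t. a ((z + t *\<^sub>R axis i 1) $ k)) has_real_derivative (if k = i then a' (z $ k) else 0)) (at 0)"
    and da': "((\<lambda>t. a' ((z + t *\<^sub>R axis i 1) $ k)) has_real_derivative (if k = i then a'' (z $ k) else 0)) (at 0)"
    for i :: 'n and z
    unfolding axis_shift_nth by (intro comp a)+
  have db': "((\<lambda>t. b' i ((z + t *\<^sub>R axis i 1) $ i)) has_real_derivative b'' i (z $ i)) (at 0)" for i and z :: "real^'n"
    unfolding axis_shift_nth using comp[OF b(2), of i "z $ i" i i] by simp
  have "axis_derivs (\<lambda>z. a (z $ k) * B z) f1 f2"
    unfolding axis_derivs_def
  proof (intro conjI allI)
    fix i z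
    show "((\<lambda>t. a ((z + t *\<^sub>R axis i 1) $ k) * B (z + t *\<^sub>R axis i 1)) has_real_derivative f1 i z) (at 0)"
      using DERIV_mult[OF da[of z i] dB[of z i]] by (auto simp: f1_def algebra_simps)
    have 1: "((\<lambda>t. a ((z + t *\<^sub>R axis i 1) $ k) * b' i ((z + t *\<^sub>R axis i 1) $ i)) has_real_derivative
        ((if k = i then a' (z $ k) * b' i (z $ i) else 0) + a (z $ k) * b'' i (z $ i))) (at 0)"
      using DERIV_mult[OF da[of z i] db'[of i z]] by (auto simp: algebra_simps)
    have 2: "((\<lambda>t. a' ((z + t *\<^sub>R axis i 1) $ k) * B (z + t *\<^sub>R axis i 1)) has_real_derivative
        ((if k = i then a'' (z $ k) * B z else 0) + a' (z $ k) * b' i (z $ i))) (at 0)"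
      using DERIV_mult[OF da'[of z i] dB[of z i]] by (auto simp: algebra_simps)
    show "((\<lambda>t. f1 i (z + t *\<^sub>R axis i 1)) has_real_derivative f2 i z) (at 0)"
      using 1 DERIV_add[OF 2 1] unfolding f1_def f2_def
      by (cases "i = k") (auto simp: algebra_simps)
  qed
  moreover have "a'' (z $ k) * B z + 2 * a' (z $ k) * b' k (z $ k) + a (z $ k) * (\<Sum>i\<in>UNIV. b'' i (z $ i))
      = (\<Sum>i\<in>UNIV. f2 i z)" for z
    unfolding f2_def by (simp add: sum.distrib sum.delta sum_distrib_left)
  ultimately show ?thesis
    unfolding has_laplacian_def by blast
qed

text \<open>
  By linearity a multiple of the one-dimensional solution \<open>(g, d)\<close> minus a solution \<open>(f, v)\<close> solves
  the same equation.
\<close>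

lemma has_laplacian_multiple_minus:
  fixes f v :: "real ^ 'n::finite \<Rightarrow> real" and g g' d \<alpha> \<gamma> :: "real \<Rightarrow> real"
  assumes f: "has_laplacian f (\<lambda>z. \<alpha> (z $ k) * f z - \<gamma> (z $ k) * v z)"
    and g: "\<And>x. (g has_real_derivative g' x) (at x)"
      "\<And>x. (g' has_real_derivative \<alpha> x * g x - \<gamma> x * d x) (at x)"
  shows "has_laplacian (\<lambda>z. M * g (z $ k) - f z)
      (\<lambda>z. \<alpha> (z $ k) * (M * g (z $ k) - f z) - \<gamma> (z $ k) * (M * d (z $ k) - v z))"
proof -
  have "has_laplacian (\<lambda>z. g (z $ k) * (\<Sum>i\<in>(UNIV::'n set). M / CARD('n)) - f z)
    (\<lambda>z. ((\<alpha> (z $ k) * g (z $ k) - \<gamma> (z $ k) * d (z $ k)) * (\<Sum>i\<in>(UNIV::'n set). M / CARD('n)) +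
          2 * g' (z $ k) * 0 + g (z $ k) * (\<Sum>i\<in>(UNIV::'n set). 0))
      - (\<alpha> (z $ k) * f z - \<gamma> (z $ k) * v z))"
    by (rule has_laplacian_diff[OF has_laplacian_weight_times_sum f]) (auto intro: g)
  then show ?thesis by (simp add: algebra_simps)
qed

text \<open>
  This reduces the partial differential equation to an ordinary one.
\<close>

lemma has_laplacian_one_variable:
  assumes "has_laplacian f l" and dep: "\<And>z w. z $ k = w $ k \<Longrightarrow> f z = f w"
  obtains f' where
    "\<And>x. ((\<lambda>x. f (x *\<^sub>R axis k 1)) has_real_derivative f' x) (at x)"
    "\<And>x. (f' has_real_derivative l (x *\<^sub>R axis k 1)) (at x)"
proof -
  from assms(1) obtain f1 f2 where
    f: "axis_derivs f f1 f2" and l: "\<And>z. l z = (\<Sum>i\<in>UNIV. f2 i z)"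
    unfolding has_laplacian_def by blast
  have f1: "f1 i z = 0" if "i \<noteq> k" for i z
  proof -
    have "((\<lambda>t. f (z + t *\<^sub>R axis i 1)) has_real_derivative f1 i z) (at 0)"
      using f unfolding axis_derivs_def by blast
    moreover have "(\<lambda>t. f (z + t *\<^sub>R axis i 1)) = (\<lambda>t. f z)"
      using that by (intro ext dep) (simp add: axis_def)
    ultimately show ?thesis using DERIV_unique[OF _ DERIV_const[of "f z"]] by simp
  qed
  have f2: "f2 i z = 0" if "i \<noteq> k" for i z
  proof -
    have "((\<lambda>t. f1 i (z + t *\<^sub>R axis i 1)) has_real_derivative f2 i z) (at 0)"
      using f unfolding axis_derivs_def by blast
    then show ?thesis using DERIV_unique[OF _ DERIV_const[of 0]] by (simp add: f1[OF that])
  qed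
  have "l z = f2 k z" for z
    unfolding l using sum.remove[of UNIV k "\<lambda>i. f2 i z"] f2 by simp
  then show ?thesis
    using axis_derivs_line[OF f, where z = 0 and i = k]
    by (intro that[of "\<lambda>t. f1 k (t *\<^sub>R axis k 1)"]) simp_all
qed

section \<open>Reflection in a coordinate hyperplane\<close>

definition reflect :: "'n::finite \<Rightarrow> real \<Rightarrow> real ^ 'n \<Rightarrow> real ^ 'n" where
  "reflect e c z = (\<chi> i. if i = e then 2 * c - z $ i else z $ i)"

lemma reflect_shift:
  "reflect e c (z + t *\<^sub>R axis i 1) = reflect e c z + (if i = e then - t else t) *\<^sub>R axis i 1"
  by (auto simp: reflect_def vec_eq_iff axis_def)

lemma continuous_on_reflect: "continuous_on S (reflect e c)"
  unfolding reflect_def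
  by (rule continuous_on_vec_lambda, case_tac "i = e") (auto intro!: continuous_intros)

lemma has_laplacian_reflect:
  assumes "has_laplacian f l"
  shows "has_laplacian (\<lambda>z. f (reflect e c z)) (\<lambda>z. l (reflect e c z))"
proof -
  from assms obtain f1 f2 where
    f: "axis_derivs f f1 f2" "\<And>z. l z = (\<Sum>i\<in>UNIV. f2 i z)"
    unfolding has_laplacian_def by blast
  have flip: "((\<lambda>t. h (- t)) has_real_derivative - d) (at 0)"
    if "(h has_real_derivative d) (at 0)" for h :: "real \<Rightarrow> real" and d
    using DERIV_mirror[of h d 0] that by simp
  have "axis_derivs (\<lambda>z. f (reflect e c z))
      (\<lambda>i z. if i = e then - f1 i (reflect e c z) else f1 i (reflect e c z))
      (\<lambda>i z. f2 i (reflect e c z))"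
    unfolding axis_derivs_def
  proof (intro conjI allI)
    fix i z
    have 1: "((\<lambda>t. f (reflect e c z + t *\<^sub>R axis i 1)) has_real_derivative f1 i (reflect e c z)) (at 0)"
      and 2: "((\<lambda>t. f1 i (reflect e c z + t *\<^sub>R axis i 1)) has_real_derivative f2 i (reflect e c z)) (at 0)"
      using f(1) unfolding axis_derivs_def by auto
    show "((\<lambda>t. f (reflect e c (z + t *\<^sub>R axis i 1))) has_real_derivative
        (if i = e then - f1 i (reflect e c z) else f1 i (reflect e c z))) (at 0)"
      using 1 flip[OF 1] by (cases "i = e") (simp_all add: reflect_shift)
    show "((\<lambda>t. if i = e then - f1 i (reflect e c (z + t *\<^sub>R axis i 1))
          else f1 i (reflect e c (z + t *\<^sub>R axis i 1))) has_real_derivative f2 i (reflect e c z)) (at 0)"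
      using 2 DERIV_minus[OF flip[OF 2]] by (cases "i = e") (simp_all add: reflect_shift)
  qed
  then show ?thesis
    unfolding has_laplacian_def f(2) by blast
qed

text \<open>
  Any two values of a coordinate are exchanged by the reflection in the hyperplane halfway between them,
  and one of the two points lies on the side where the symmetry is assumed. So one coordinate after the
  other can be changed.
\<close>

lemma depends_on_one_coordinate_if_reflection_symmetric:
  fixes f :: "real ^ 'n::finite \<Rightarrow> 'a"
  assumes sym: "\<And>e c z. e \<noteq> k \<Longrightarrow> c \<le> z $ e \<Longrightarrow> f (reflect e c z) = f z"
    and zw: "z $ k = w $ k"
  shows "f z = f w"
proof -
  have update: "f (\<chi> i. if i = e then s else z $ i) = f z" if "e \<noteq> k" for e s z
  proof -
    define z' where "z' = (\<chi> i. if i = e then s else z $ i)"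
    define c where "c = (s + z $ e) / 2"
    have "2 * c = s + z $ e" by (simp add: c_def)
    then have 1: "reflect e c z = z'" and 2: "reflect e c z' = z"
      by (auto simp: reflect_def z'_def vec_eq_iff)
    have "c \<le> z $ e \<or> c \<le> z' $ e" by (auto simp: c_def z'_def)
    then have "f z' = f z"
      using sym[OF that, of c z] sym[OF that, of c z'] 1 2 by auto
    then show ?thesis by (simp add: z'_def)
  qed
  have "f (\<chi> i. if i \<in> S then w $ i else z $ i) = f z" if "finite S" "k \<notin> S" for S
    using that
  proof (induction S rule: finite_induct)
    case (insert e S)
    have "(\<chi> i. if i \<in> insert e S then w $ i else z $ i) =
        (\<chi> i. if i = e then w $ e else (\<chi> i. if i \<in> S then w $ i else z $ i) $ i)"
      by (auto simp: vec_eq_iff)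
    then show ?case using insert update[of e "w $ e"] by auto
  qed simp
  from this[of "- {k}"] have "f (\<chi> i. if i \<in> - {k} then w $ i else z $ i) = f z" by simp
  moreover have "(\<chi> i. if i \<in> - {k} then w $ i else z $ i) = w"
    using zw by (auto simp: vec_eq_iff)
  ultimately show ?thesis by simp
qed

section \<open>Interior minima and maximum principles\<close>

text \<open>
  If the second derivative were negative, the first derivative, which vanishes at \<open>0\<close>, would be negative
  shortly after \<open>0\<close>.
\<close>

lemma second_derivative_nonneg_at_local_min:
  fixes g g' :: "real \<Rightarrow> real"
  assumes g: "\<And>t. (g has_real_derivative g' t) (at t)"
    and g': "(g' has_real_derivative l) (at 0)"
    and r: "r > 0" "\<And>t. \<bar>t\<bar> < r \<Longrightarrow> g 0 \<le> g t"
  shows "0 \<le> l"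
proof (rule ccontr)
  assume "\<not> 0 \<le> l"
  have "g' 0 = 0"
    by (rule DERIV_local_min[OF g r(1)]) (use r(2) in auto)
  with DERIV_neg_dec_right[OF g'] \<open>\<not> 0 \<le> l\<close>
  obtain d where d: "d > 0" "\<And>h. 0 < h \<Longrightarrow> h < d \<Longrightarrow> g' h < 0" by auto
  define s where "s = min d r / 2"
  have s: "0 < s" "s < d" "s < r" using d(1) r(1) by (auto simp: s_def)
  obtain \<xi> where "0 < \<xi>" "\<xi> < s" "g s - g 0 = (s - 0) * g' \<xi>"
    using MVT2[OF s(1), of g g'] g by blast
  with d(2)[of \<xi>] s r(2)[of s] show False
    by (auto simp: mult_less_0_iff) (smt (verit) mult_pos_neg)
qed

lemma laplacian_nonneg_at_local_min:
  fixes f :: "real ^ 'n::finite \<Rightarrow> real"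
  assumes f: "has_laplacian f l" and S: "open S" "z0 \<in> S" "\<And>z. z \<in> S \<Longrightarrow> f z0 \<le> f z"
  shows "0 \<le> l z0"
proof -
  from f obtain f1 f2 where
    f12: "axis_derivs f f1 f2" and l: "\<And>z. l z = (\<Sum>i\<in>UNIV. f2 i z)"
    unfolding has_laplacian_def by blast
  obtain r where r: "r > 0" "ball z0 r \<subseteq> S"
    using S openE by blast
  have "0 \<le> f2 i z0" for i
  proof (rule second_derivative_nonneg_at_local_min)
    show "((\<lambda>t. f (z0 + t *\<^sub>R axis i 1)) has_real_derivative f1 i (z0 + t *\<^sub>R axis i 1)) (at t)" for t
      by (rule axis_derivs_line[OF f12])
    show "((\<lambda>t. f1 i (z0 + t *\<^sub>R axis i 1)) has_real_derivative f2 i z0) (at 0)"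
      using f12 unfolding axis_derivs_def by blast
    show "f (z0 + 0 *\<^sub>R axis i 1) \<le> f (z0 + t *\<^sub>R axis i 1)" if "\<bar>t\<bar> < r" for t
    proof -
      have "z0 + t *\<^sub>R axis i 1 \<in> ball z0 r" using that by (simp add: dist_norm)
      then show ?thesis using r(2) S(3) by auto
    qed
  qed (rule r)
  then show ?thesis by (simp add: l sum_nonneg)
qed

lemma negative_minimum_attained:
  fixes h :: "real ^ 'n::finite \<Rightarrow> real"
  assumes "continuous_on UNIV h" "closed S" "z1 \<in> S" "h z1 < 0"
    and far: "\<And>z. z \<in> S \<Longrightarrow> R \<le> norm z \<Longrightarrow> 0 \<le> h z"
  obtains z0 where "z0 \<in> S" "h z0 < 0" "\<And>z. z \<in> S \<Longrightarrow> h z0 \<le> h z"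
proof -
  have comp: "compact (S \<inter> cball 0 R)"
    using assms(2) by (simp add: closed_Int_compact)
  have z1: "z1 \<in> S \<inter> cball 0 R"
    using assms(3,4) far[of z1] by force
  obtain z0 where z0: "z0 \<in> S \<inter> cball 0 R" "\<And>z. z \<in> S \<inter> cball 0 R \<Longrightarrow> h z0 \<le> h z"
    using continuous_attains_inf[OF comp _ continuous_on_subset[OF assms(1)]] z1 by blast
  have "h z0 < 0" using z0(2)[OF z1] assms(4) by simp
  moreover have "h z0 \<le> h z" if "z \<in> S" for z
    using z0(2)[of z] far[of z] that \<open>h z0 < 0\<close> by (cases "norm z \<le> R") auto
  ultimately show ?thesis using that z0(1) by blast
qed

lemma sum_power2_nth: "(\<Sum>i\<in>UNIV. (z $ i)\<^sup>2) = (norm (z :: real ^ 'n::finite))\<^sup>2"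
  unfolding power2_norm_eq_inner by (simp add: inner_vec_def power2_eq_square)

lemma nonpos_if_le_small_multiples:
  fixes x W :: real
  assumes "\<And>\<eta>. \<eta> > 0 \<Longrightarrow> x \<le> \<eta> * W"
  shows "x \<le> 0"
proof (rule ccontr)
  assume x: "\<not> x \<le> 0"
  with assms[of 1] have "W > 0" by simp
  with x assms[of "x / (2 * W)"] show False by simp
qed

text \<open>
  The scalar maximum principle on a half-space, whose side is chosen by the sign of \<open>s\<close>. The half-space is
  unbounded, so the minimum of \<open>f\<close> need not be attained; adding \<open>\<eta> (\<bar>z\<bar>\<^sup>2 + const)\<close> makes it attained.
  The positive zeroth-order coefficient lets the constant absorb the Laplacian of \<open>\<eta> \<bar>z\<bar>\<^sup>2\<close>.
\<close>

lemma halfspace_maximum_principle: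
  fixes f :: "real ^ 'n::finite \<Rightarrow> real" and s :: real
  assumes f: "continuous_on UNIV f" "has_laplacian f l"
    and super: "\<And>z. s * z $ k < 0 \<Longrightarrow> f z < 0 \<Longrightarrow> l z \<le> c0 * f z" and "c0 > 0"
    and bdd: "\<And>z. - C \<le> f z"
    and boundary: "\<And>z. s * z $ k = 0 \<Longrightarrow> 0 \<le> f z"
    and z: "s * z $ k \<le> 0"
  shows "0 \<le> f z"
proof -
  define N where "N = real CARD('n)"
  have "- f z \<le> \<eta> * ((norm z)\<^sup>2 + N * (2 / c0))" if "\<eta> > 0" for \<eta>
  proof (rule ccontr)
    assume contra: "\<not> ?thesis"
    \<comment> \<open>The constant \<open>2 / c0\<close> per coordinate is the one for which \<open>c0\<close> times it equals the second
       derivative of the square. The form with the weight \<open>1\<close> matches \<open>has_laplacian_weight_times_sum\<close>.\<close>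
    define h where "h = (\<lambda>z. f z - 1 * (\<Sum>i\<in>UNIV. - \<eta> * ((z $ i)\<^sup>2 + 2 / c0)))"
    have h: "h z = f z + \<eta> * ((norm z)\<^sup>2 + N * (2 / c0))" for z
      unfolding h_def by (simp add: sum_power2_nth[symmetric] sum_negf sum_distrib_left[symmetric] sum.distrib N_def)
    have "has_laplacian h (\<lambda>z. l z - (0 * (\<Sum>i\<in>UNIV. - \<eta> * ((z $ i)\<^sup>2 + 2 / c0)) + 2 * 0 * (- \<eta> * (2 * z $ k)) + 1 * (\<Sum>i\<in>(UNIV::'n set). - \<eta> * 2)))"
      unfolding h_def
      by (intro has_laplacian_diff f has_laplacian_weight_times_sum) (auto intro!: derivative_eq_intros)
    then have lap: "has_laplacian h (\<lambda>z. l z + 2 * \<eta> * N)"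
      by (simp add: N_def mult.commute mult.left_commute)
    obtain z0 where z0: "s * z0 $ k \<le> 0" "h z0 < 0" "\<And>z. s * z $ k \<le> 0 \<Longrightarrow> h z0 \<le> h z"
    proof (rule negative_minimum_attained[of h "{z. s * z $ k \<le> 0}" z "\<bar>C\<bar> / \<eta> + 1"])
      show "continuous_on UNIV h"
        unfolding h_def by (intro continuous_intros f)
      show "closed {z. s * z $ k \<le> 0}"
        by (intro closed_Collect_le continuous_intros)
      show "h z < 0" using contra by (simp add: h)
      show "0 \<le> h z" if "\<bar>C\<bar> / \<eta> + 1 \<le> norm z" for z
      proof -
        have "1 \<le> norm z"
          using that \<open>\<eta> > 0\<close> by (smt (verit) divide_nonneg_pos)
        then have "norm z \<le> (norm z)\<^sup>2" by (rule self_le_power) simp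
        with that have "\<bar>C\<bar> / \<eta> \<le> (norm z)\<^sup>2" by linarith
        then have "\<bar>C\<bar> \<le> \<eta> * (norm z)\<^sup>2" using \<open>\<eta> > 0\<close> by (simp add: field_simps)
        moreover have "0 \<le> \<eta> * (N * (2 / c0))" using \<open>\<eta> > 0\<close> \<open>c0 > 0\<close> by (simp add: N_def)
        ultimately show ?thesis using bdd[of z] unfolding h distrib_left by linarith
      qed
    qed (use z in auto)
    have pos: "0 \<le> \<eta> * (norm z0)\<^sup>2" "0 \<le> \<eta> * (N * (2 / c0))"
      using \<open>\<eta> > 0\<close> \<open>c0 > 0\<close> by (simp_all add: N_def)
    have f0: "f z0 + \<eta> * (norm z0)\<^sup>2 + \<eta> * (N * (2 / c0)) < 0"
      using z0(2) unfolding h distrib_left by simp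
    have "s * z0 $ k \<noteq> 0"
    proof
      assume "s * z0 $ k = 0"
      from boundary[OF this] f0 pos show False by linarith
    qed
    then have neg: "s * z0 $ k < 0" using z0(1) by linarith
    have "0 \<le> l z0 + 2 * \<eta> * N"
    proof (rule laplacian_nonneg_at_local_min[OF lap])
      show "open {z. s * z $ k < 0}" by (intro open_Collect_less continuous_intros)
    qed (use neg z0(3) in auto)
    moreover have "l z0 \<le> c0 * f z0"
      using super[OF neg] f0 pos by linarith
    moreover have "c0 * f z0 < c0 * (- (\<eta> * (N * (2 / c0))))"
      using f0 pos \<open>c0 > 0\<close> by (intro mult_strict_left_mono) auto
    ultimately show False using \<open>c0 > 0\<close> by simp
  qed
  then have "- f z \<le> 0" by (rule nonpos_if_le_small_multiples)
  then show ?thesis by simp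
qed

text \<open>
  The maximum principle for the cooperative system, at one point. Here \<open>(a, d)\<close> is the positive
  one-dimensional solution and \<open>(w, v)\<close> another solution. Let \<open>m\<close> be the value of the local minimum of
  \<open>B - w / a\<close>. Then \<open>a (B - m) - w\<close> is nonnegative near \<open>z0\<close> and vanishes there. In its Laplacian, the
  terms with \<open>\<alpha>\<close> cancel and the coupling contributes \<open>- \<gamma> (d (B - m) - v)\<close>, which is nonpositive when
  the other ratio difference is at least \<open>m\<close>. What remains is the expression in the conclusion; a strict
  supersolution \<open>B\<close> makes it negative, so that no such minimum exists.
\<close>

lemma ratio_touching:
  fixes a a' a'' d \<alpha> \<gamma> :: "real \<Rightarrow> real" and b b' b'' :: "'n::finite \<Rightarrow> real \<Rightarrow> real"
    and w v :: "real ^ 'n \<Rightarrow> real"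
  assumes a: "\<And>x. (a has_real_derivative a' x) (at x)" "\<And>x. (a' has_real_derivative a'' x) (at x)"
    and ode: "\<And>x. a'' x = \<alpha> x * a x - \<gamma> x * d x"
    and pos: "\<And>x. a x > 0" "\<And>x. d x > 0" "\<And>x. \<gamma> x \<ge> 0"
    and w: "has_laplacian w (\<lambda>z. \<alpha> (z $ k) * w z - \<gamma> (z $ k) * v z)"
    and b: "\<And>i x. (b i has_real_derivative b' i x) (at x)"
           "\<And>i x. (b' i has_real_derivative b'' i x) (at x)"
  defines "B \<equiv> \<lambda>z. \<Sum>i\<in>UNIV. b i (z $ i)"
  assumes S: "open S" "z0 \<in> S"
    and min: "\<And>z. z \<in> S \<Longrightarrow> B z0 - w z0 / a (z0 $ k) \<le> B z - w z / a (z $ k)"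
    and cross: "B z0 - w z0 / a (z0 $ k) \<le> B z0 - v z0 / d (z0 $ k)"
  shows "0 \<le> 2 * a' (z0 $ k) * b' k (z0 $ k) + a (z0 $ k) * (\<Sum>i\<in>UNIV. b'' i (z0 $ i))"
proof -
  define m where "m = B z0 - w z0 / a (z0 $ k)"
  \<comment> \<open>The constant \<open>m\<close> is spread over the summands so that \<open>B - m\<close> is again a sum of functions of
     one coordinate each.\<close>
  define B' where "B' = (\<lambda>z::real^'n. \<Sum>i\<in>UNIV. b i (z $ i) - m / CARD('n))"
  have B': "B' z = B z - m" for z
    unfolding B'_def B_def by (simp add: sum_subtractf)
  have lap: "has_laplacian (\<lambda>z. a (z $ k) * B' z - w z)
     (\<lambda>z. (a'' (z $ k) * B' z + 2 * a' (z $ k) * b' k (z $ k) + a (z $ k) * (\<Sum>i\<in>UNIV. b'' i (z $ i)))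
       - (\<alpha> (z $ k) * w z - \<gamma> (z $ k) * v z))"
    unfolding B'_def
    by (intro has_laplacian_diff w has_laplacian_weight_times_sum a)
      (use b in \<open>auto intro!: derivative_eq_intros\<close>)
  have z0: "a (z0 $ k) * B' z0 = w z0"
    using pos(1)[of "z0 $ k"] by (simp add: B' m_def)
  have "0 \<le> (a'' (z0 $ k) * B' z0 + 2 * a' (z0 $ k) * b' k (z0 $ k) + a (z0 $ k) * (\<Sum>i\<in>UNIV. b'' i (z0 $ i)))
       - (\<alpha> (z0 $ k) * w z0 - \<gamma> (z0 $ k) * v z0)"
  proof (rule laplacian_nonneg_at_local_min[OF lap S])
    fix z assume "z \<in> S"
    then have "w z / a (z $ k) \<le> B' z"
      using min[of z] by (simp add: B' m_def)
    then have "w z \<le> a (z $ k) * B' z"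
      using pos(1)[of "z $ k"] by (simp add: field_simps)
    then show "a (z0 $ k) * B' z0 - w z0 \<le> a (z $ k) * B' z - w z"
      by (simp add: z0)
  qed
  moreover have "a'' (z0 $ k) * B' z0 = \<alpha> (z0 $ k) * w z0 - \<gamma> (z0 $ k) * (d (z0 $ k) * B' z0)"
    unfolding ode z0[symmetric] by (simp add: algebra_simps)
  moreover have "v z0 / d (z0 $ k) \<le> B' z0"
    using cross by (simp add: B' m_def)
  then have "v z0 \<le> d (z0 $ k) * B' z0"
    using pos(2)[of "z0 $ k"] by (simp add: field_simps)
  then have "\<gamma> (z0 $ k) * v z0 \<le> \<gamma> (z0 $ k) * (d (z0 $ k) * B' z0)"
    using pos(3) by (rule mult_left_mono)
  ultimately show ?thesis by linarith
qed

section \<open>The one-dimensional profile\<close>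

locale reflected_profile =
  fixes U V :: "real \<Rightarrow> real"
  assumes profile: "profile U V"
begin

text \<open>
  The pair \<open>(p, q)\<close> is the derivative of the profile under translation, with the sign of the second
  component changed. It solves the linearised system in its cooperative form.
\<close>

definition p :: "real \<Rightarrow> real" where "p = deriv U"

definition q :: "real \<Rightarrow> real" where "q x = - deriv V x"

lemma U_pos: "U x > 0" and V_pos: "V x > 0" and U_minus: "U (- x) = V x"
  using profile by (auto simp: profile_def)

lemma V_minus: "V (- x) = U x"
  using U_minus[of "- x"] by simp

lemma U_deriv: "(U has_real_derivative p x) (at x)"
  using profile by (simp add: profile_def p_def DERIV_deriv_iff_real_differentiable)

lemma V_deriv: "(V has_real_derivative - q x) (at x)"
  using profile by (simp add: profile_def q_def DERIV_deriv_iff_real_differentiable)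

lemma p_deriv: "(p has_real_derivative (V x)\<^sup>2 * U x) (at x)"
proof -
  have "deriv U differentiable at x" "deriv (deriv U) x = (V x)\<^sup>2 * U x"
    using profile unfolding profile_def by (auto simp: algebra_simps)
  then show ?thesis
    using DERIV_deriv_iff_real_differentiable[of "deriv U" x] by (simp add: p_def)
qed

lemma q_deriv: "(q has_real_derivative - ((U x)\<^sup>2 * V x)) (at x)"
proof -
  have "deriv V differentiable at x" "deriv (deriv V) x = (U x)\<^sup>2 * V x"
    using profile unfolding profile_def by (auto simp: algebra_simps)
  then have "((\<lambda>x. - deriv V x) has_real_derivative - ((U x)\<^sup>2 * V x)) (at x)"
    using DERIV_deriv_iff_real_differentiable[of "deriv V" x] by (intro DERIV_minus) simp
  then show ?thesis by (simp add: q_def[abs_def])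
qed

lemma p_deriv2: "((\<lambda>x. (V x)\<^sup>2 * U x) has_real_derivative (V x)\<^sup>2 * p x - 2 * U x * V x * q x) (at x)"
  by (auto intro!: derivative_eq_intros U_deriv V_deriv simp: algebra_simps)

lemma q_deriv2: "((\<lambda>x. - ((U x)\<^sup>2 * V x)) has_real_derivative (U x)\<^sup>2 * q x - 2 * U x * V x * p x) (at x)"
  by (auto intro!: derivative_eq_intros U_deriv V_deriv simp: algebra_simps)

lemma q_minus: "q (- x) = p x"
proof -
  have "((\<lambda>x. V (- x)) has_real_derivative q (- x)) (at x)"
    using V_deriv[of "- x"] DERIV_mirror[of V "- q (- x)" x] by simp
  then show ?thesis
    unfolding V_minus by (rule DERIV_unique[OF _ U_deriv])
qed

lemma p_minus: "p (- x) = q x"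
  using q_minus[of "- x"] by simp

lemma p_strict_mono: "x < y \<Longrightarrow> p x < p y"
proof (rule DERIV_pos_imp_increasing[of x y p])
  show "\<exists>d. (p has_real_derivative d) (at t) \<and> d > 0" for t
    using p_deriv[of t] U_pos[of t] V_pos[of t] by (metis mult_pos_pos zero_less_power)
qed

lemma p_mono: "x \<le> y \<Longrightarrow> p x \<le> p y"
  using p_strict_mono by (cases "x = y") (auto simp: less_le)

lemma q_antimono: "x \<le> y \<Longrightarrow> q y \<le> q x"
  using p_mono[of "- y" "- x"] by (simp add: p_minus)

text \<open>
  As \<open>U\<close> is strictly convex, a nonpositive slope somewhere would make \<open>U\<close> unbounded at \<open>- \<infinity>\<close>, where it tends
  to \<open>0\<close>.
\<close>

lemma p_pos: "p x > 0"
proof (rule ccontr)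
  assume "\<not> p x > 0"
  define y where "y = x - 1"
  define c where "c = - p y"
  have "c > 0" using p_strict_mono[of y x] \<open>\<not> p x > 0\<close> by (simp add: c_def y_def)
  \<comment> \<open>To the left of \<open>y\<close> the slope of \<open>U\<close> is at most \<open>- c\<close>.\<close>
  have grow: "U y + c * y \<le> U t + c * t" if "t \<le> y" for t
  proof (rule DERIV_nonpos_imp_nonincreasing[OF that, of "\<lambda>s. U s + c * s"])
    fix s assume "s \<le> y"
    then show "\<exists>d. ((\<lambda>s. U s + c * s) has_real_derivative d) (at s) \<and> d \<le> 0"
      using p_mono[of s y]
      by (intro exI[of _ "p s + c"]) (auto intro!: derivative_eq_intros U_deriv simp: c_def)
  qed
  have "eventually (\<lambda>t. U t < 1) at_bot"
    using profile by (intro order_tendstoD(2)[of U 0]) (auto simp: profile_def)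
  moreover have "eventually (\<lambda>t. t \<le> min y (y - 1 / c)) at_bot"
    by (rule eventually_le_at_bot)
  ultimately have "eventually (\<lambda>t. U t < 1 \<and> t \<le> min y (y - 1 / c)) at_bot"
    by (rule eventually_conj)
  then have "\<exists>t. U t < 1 \<and> t \<le> min y (y - 1 / c)"
    by (rule eventually_happens'[rotated]) simp
  then obtain t where t: "U t < 1" "t \<le> y" "t \<le> y - 1 / c"
    by auto
  have "1 \<le> c * (y - t)" using t(3) \<open>c > 0\<close> by (simp add: field_simps)
  with grow[OF t(2)] t(1) U_pos[of y] show False by (simp add: algebra_simps)
qed

lemma q_pos: "q x > 0"
  using p_pos[of "- x"] by (simp add: p_minus)

lemma p_le_1: "p x \<le> 1"
proof (rule tendsto_lowerbound)
  show "(p \<longlongrightarrow> 1) at_top" using profile by (simp add: profile_def p_def)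
  show "eventually (\<lambda>y. p x \<le> p y) at_top"
    using eventually_ge_at_top[of x] by eventually_elim (rule p_mono)
qed simp

lemma q_le_1: "q x \<le> 1"
  using p_le_1[of "- x"] by (simp add: p_minus)

lemma U_mono: "x \<le> y \<Longrightarrow> U x \<le> U y"
  using DERIV_nonneg_imp_nondecreasing[of x y U] U_deriv p_pos less_imp_le by metis

lemma V_antimono: "x \<le> y \<Longrightarrow> V y \<le> V x"
  using U_mono[of "- y" "- x"] by (simp add: U_minus)

text \<open>
  The profile is a trajectory of a Hamiltonian system with energy \<open>U'\<^sup>2 + V'\<^sup>2 - U\<^sup>2 V\<^sup>2\<close>, and its
  velocities are at most \<open>1\<close>.
\<close>

lemma UV_bounded: obtains C where "\<And>x. (U x * V x)\<^sup>2 \<le> C"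
proof -
  define H where "H = (\<lambda>x. (p x)\<^sup>2 + (q x)\<^sup>2 - (U x * V x)\<^sup>2)"
  have "(H has_real_derivative 0) (at x)" for x
    unfolding H_def
    by (auto intro!: derivative_eq_intros U_deriv V_deriv p_deriv q_deriv simp: algebra_simps power2_eq_square)
  then have H: "H x = H 0" for x by (intro DERIV_isconst_all) auto
  have "(U x * V x)\<^sup>2 \<le> 2 - H 0" for x
  proof -
    have "(p x)\<^sup>2 \<le> 1" "(q x)\<^sup>2 \<le> 1"
      using p_le_1[of x] q_le_1[of x] p_pos[of x] q_pos[of x] by (simp_all add: power_le_one)
    moreover have "(p x)\<^sup>2 + (q x)\<^sup>2 - (U x * V x)\<^sup>2 = H 0"
      using H[of x] by (simp add: H_def)
    ultimately show ?thesis by linarith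
  qed
  then show ?thesis using that by blast
qed

text \<open>
  For \<open>x > 0\<close> convexity gives \<open>U x \<ge> p 0 * x\<close>, so \<open>x p'\<close>, that is \<open>x V\<^sup>2 U\<close>, is at most \<open>(U V)\<^sup>2 / p 0\<close>,
  while \<open>p\<close> is at least \<open>p 0\<close>. For \<open>x < 0\<close> the left-hand side is negative. The bound for \<open>q\<close> is the
  mirror image. This is what makes \<open>\<bar>z\<bar>\<^sup>2\<close> an admissible barrier with the weights \<open>p\<close> and \<open>q\<close>.
\<close>

lemma log_derivative_bound:
  obtains K where "K \<ge> 0" "\<And>x. x * ((V x)\<^sup>2 * U x) \<le> K * p x" "\<And>x. x * - ((U x)\<^sup>2 * V x) \<le> K * q x"
proof -
  obtain C where C: "\<And>x. (U x * V x)\<^sup>2 \<le> C" using UV_bounded by blast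
  have "C \<ge> 0" using C[of 0] by (meson order_trans zero_le_power2)
  define K where "K = C / (p 0)\<^sup>2"
  have "K \<ge> 0" using \<open>C \<ge> 0\<close> by (simp add: K_def)
  have linear: "p 0 * x \<le> U x" if "0 \<le> x" for x
  proof -
    have "U 0 - p 0 * 0 \<le> U x - p 0 * x"
    proof (rule DERIV_nonneg_imp_nondecreasing[OF that, of "\<lambda>x. U x - p 0 * x"])
      fix s :: real assume "0 \<le> s"
      then show "\<exists>d. ((\<lambda>x. U x - p 0 * x) has_real_derivative d) (at s) \<and> 0 \<le> d"
        using p_mono[of 0 s]
        by (intro exI[of _ "p s - p 0"]) (auto intro!: derivative_eq_intros U_deriv)
    qed
    with U_pos[of 0] show ?thesis by simp
  qed
  have 1: "x * ((V x)\<^sup>2 * U x) \<le> K * p x" for x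
  proof (cases "0 \<le> x")
    case True
    have "p 0 * (x * ((V x)\<^sup>2 * U x)) = (p 0 * x) * ((V x)\<^sup>2 * U x)" by simp
    also have "\<dots> \<le> U x * ((V x)\<^sup>2 * U x)"
      using linear[OF True] U_pos[of x] by (intro mult_right_mono) auto
    also have "\<dots> = (U x * V x)\<^sup>2" by (simp add: power2_eq_square)
    also have "\<dots> \<le> C" by (rule C)
    also have "C = p 0 * (K * p 0)" using p_pos[of 0] by (simp add: K_def power2_eq_square)
    also have "\<dots> \<le> p 0 * (K * p x)"
      using p_mono[OF True] p_pos[of 0] \<open>K \<ge> 0\<close> by (intro mult_left_mono) auto
    finally show ?thesis using p_pos[of 0] by simp
  next
    case False
    then have "x * ((V x)\<^sup>2 * U x) \<le> 0"
      using U_pos[of x] V_pos[of x] by (simp add: mult_le_0_iff)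
    moreover have "0 \<le> K * p x" using \<open>K \<ge> 0\<close> p_pos[of x] by simp
    ultimately show ?thesis by linarith
  qed
  have 2: "x * - ((U x)\<^sup>2 * V x) \<le> K * q x" for x
    using 1[of "- x"] by (simp add: U_minus V_minus p_minus)
  show ?thesis using that[OF \<open>K \<ge> 0\<close> 1 2] .
qed

lemma continuous_on_p: "continuous_on S p" and continuous_on_q: "continuous_on S q"
  by (rule DERIV_continuous_on, rule has_field_derivative_at_within, rule p_deriv q_deriv)+

section \<open>Bounded solutions are dominated by the translation mode\<close>

text \<open>
  The cooperative form of the system: \<open>\<psi>\<close> is the second component with its sign changed.
\<close>

definition linearised_solution ::
    "'n::finite \<Rightarrow> (real ^ 'n \<Rightarrow> real) \<Rightarrow> (real ^ 'n \<Rightarrow> real) \<Rightarrow> bool" where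
  "linearised_solution k \<phi> \<psi> \<longleftrightarrow>
     continuous_on UNIV \<phi> \<and> continuous_on UNIV \<psi> \<and>
     has_laplacian \<phi> (\<lambda>z. (V (z $ k))\<^sup>2 * \<phi> z - 2 * U (z $ k) * V (z $ k) * \<psi> z) \<and>
     has_laplacian \<psi> (\<lambda>z. (U (z $ k))\<^sup>2 * \<psi> z - 2 * U (z $ k) * V (z $ k) * \<phi> z)"

lemma linearised_solution_minus:
  assumes "linearised_solution k \<phi> \<psi>"
  shows "linearised_solution k (\<lambda>z. - \<phi> z) (\<lambda>z. - \<psi> z)"
  using assms has_laplacian_minus[of \<phi>] has_laplacian_minus[of \<psi>]
  unfolding linearised_solution_def by (fastforce intro: continuous_on_minus)

lemma linearised_solution_diff_reflect:
  fixes \<phi> \<psi> :: "real ^ 'n::finite \<Rightarrow> real"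
  assumes sol: "linearised_solution k \<phi> \<psi>" and "e \<noteq> k"
  shows "linearised_solution k (\<lambda>z. \<phi> z - \<phi> (reflect e c z)) (\<lambda>z. \<psi> z - \<psi> (reflect e c z))"
proof -
  have k: "reflect e c z $ k = z $ k" for z
    using \<open>e \<noteq> k\<close> by (simp add: reflect_def)
  have cont: "continuous_on UNIV (\<lambda>z. f z - f (reflect e c z))"
    if "continuous_on UNIV f" for f :: "real ^ 'n \<Rightarrow> real"
    using that by (intro continuous_intros continuous_on_compose2[OF that continuous_on_reflect]) auto
  have lap: "has_laplacian (\<lambda>z. f z - f (reflect e c z))
      (\<lambda>z. \<alpha> (z $ k) * (f z - f (reflect e c z)) - \<gamma> (z $ k) * (g z - g (reflect e c z)))"
    if "has_laplacian f (\<lambda>z. \<alpha> (z $ k) * f z - \<gamma> (z $ k) * g z)"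
    for f g and \<alpha> \<gamma> :: "real \<Rightarrow> real"
    using has_laplacian_diff[OF that has_laplacian_reflect[OF that, of e c]]
    unfolding k by (simp add: algebra_simps)
  show ?thesis
    using sol cont[of \<phi>] cont[of \<psi>]
      lap[of \<phi> "\<lambda>x. (V x)\<^sup>2" "\<lambda>x. 2 * U x * V x" \<psi>] lap[of \<psi> "\<lambda>x. (U x)\<^sup>2" "\<lambda>x. 2 * U x * V x" \<phi>]
    unfolding linearised_solution_def by simp
qed

text \<open>
  On the side where \<open>p\<close> is at least \<open>p 0\<close>, the bound on \<open>\<phi>\<close> is trivial, and likewise for \<open>q\<close> and \<open>\<psi>\<close>
  on the other side. Where the bound on \<open>\<phi>\<close> is not trivial, the one on \<open>\<psi>\<close> is, so the coupling term has
  the right sign and the scalar maximum principle applies to \<open>M p - \<phi>\<close>.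
\<close>

lemma bounded_solution_le_profile:
  fixes \<phi> \<psi> :: "real ^ 'n::finite \<Rightarrow> real"
  assumes sol: "linearised_solution k \<phi> \<psi>"
    and C: "\<And>z. \<bar>\<phi> z\<bar> \<le> C" "\<And>z. \<bar>\<psi> z\<bar> \<le> C"
  shows "\<phi> z \<le> C / p 0 * p (z $ k)" "\<psi> z \<le> C / p 0 * q (z $ k)"
proof -
  have sol': "continuous_on UNIV \<phi>" "continuous_on UNIV \<psi>"
      "has_laplacian \<phi> (\<lambda>z. (V (z $ k))\<^sup>2 * \<phi> z - 2 * U (z $ k) * V (z $ k) * \<psi> z)"
      "has_laplacian \<psi> (\<lambda>z. (U (z $ k))\<^sup>2 * \<psi> z - 2 * U (z $ k) * V (z $ k) * \<phi> z)"
    using sol by (auto simp: linearised_solution_def)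
  define M where "M = C / p 0"
  have "C \<ge> 0" using C(1)[of 0] by linarith
  then have "M \<ge> 0" using p_pos[of 0] by (simp add: M_def)
  have q0: "q 0 = p 0" using q_minus[of 0] by simp
  have large: "x \<le> M * r" if "x \<le> C" "p 0 \<le> r" for x r
  proof -
    have "C = M * p 0" using p_pos[of 0] by (simp add: M_def)
    also have "\<dots> \<le> M * r" using that(2) \<open>M \<ge> 0\<close> by (rule mult_left_mono)
    finally show ?thesis using that(1) by simp
  qed
  have p_large: "\<phi> z \<le> M * p (z $ k)" if "0 \<le> z $ k" for z
    using C(1)[of z] p_mono[OF that] by (intro large) auto
  have q_large: "\<psi> z \<le> M * q (z $ k)" if "z $ k \<le> 0" for z
    using C(2)[of z] q_antimono[OF that] by (intro large) (auto simp: q0)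
  have "0 \<le> M * p (z $ k) - \<phi> z" if "z $ k \<le> 0"
  proof (rule halfspace_maximum_principle[where s = 1 and k = k and C = C and ?c0.0 = "(V 0)\<^sup>2"])
    show "continuous_on UNIV (\<lambda>z. M * p (z $ k) - \<phi> z)"
      by (intro continuous_intros sol' continuous_on_compose2[OF continuous_on_p[of UNIV]]) auto
    show "has_laplacian (\<lambda>z. M * p (z $ k) - \<phi> z)
        (\<lambda>z. (V (z $ k))\<^sup>2 * (M * p (z $ k) - \<phi> z) - 2 * U (z $ k) * V (z $ k) * (M * q (z $ k) - \<psi> z))"
      by (rule has_laplacian_multiple_minus[where \<alpha> = "\<lambda>x. (V x)\<^sup>2" and \<gamma> = "\<lambda>x. 2 * U x * V x", OF sol'(3) p_deriv p_deriv2])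
    show "(V (y $ k))\<^sup>2 * (M * p (y $ k) - \<phi> y) - 2 * U (y $ k) * V (y $ k) * (M * q (y $ k) - \<psi> y)
        \<le> (V 0)\<^sup>2 * (M * p (y $ k) - \<phi> y)"
      if "1 * y $ k < 0" "M * p (y $ k) - \<phi> y < 0" for y
    proof -
      have "(V 0)\<^sup>2 \<le> (V (y $ k))\<^sup>2"
        using that(1) V_antimono[of "y $ k" 0] V_pos[of 0] by (intro power_mono) auto
      then have "(V (y $ k))\<^sup>2 * (M * p (y $ k) - \<phi> y) \<le> (V 0)\<^sup>2 * (M * p (y $ k) - \<phi> y)"
        using that(2) by (intro mult_right_mono_neg) auto
      moreover have "0 \<le> 2 * U (y $ k) * V (y $ k) * (M * q (y $ k) - \<psi> y)"
        using U_pos[of "y $ k"] V_pos[of "y $ k"] q_large[of y] that(1) by (intro mult_nonneg_nonneg) auto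
      ultimately show ?thesis by linarith
    qed
    show "- C \<le> M * p (y $ k) - \<phi> y" for y
    proof -
      have "0 \<le> M * p (y $ k)" using \<open>M \<ge> 0\<close> p_pos[of "y $ k"] by simp
      then show ?thesis using C(1)[of y] by linarith
    qed
    show "0 \<le> M * p (y $ k) - \<phi> y" if "1 * y $ k = 0" for y
      using p_large[of y] that by simp
    show "0 < (V 0)\<^sup>2" using V_pos[of 0] by simp
  qed (use that in simp)
  then show "\<phi> z \<le> C / p 0 * p (z $ k)"
    using p_large[of z] by (cases "z $ k \<le> 0") (auto simp: M_def)
  have "0 \<le> M * q (z $ k) - \<psi> z" if "0 \<le> z $ k"
  proof (rule halfspace_maximum_principle[where s = "- 1" and k = k and C = C and ?c0.0 = "(U 0)\<^sup>2"])
    show "continuous_on UNIV (\<lambda>z. M * q (z $ k) - \<psi> z)"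
      by (intro continuous_intros sol' continuous_on_compose2[OF continuous_on_q[of UNIV]]) auto
    show "has_laplacian (\<lambda>z. M * q (z $ k) - \<psi> z)
        (\<lambda>z. (U (z $ k))\<^sup>2 * (M * q (z $ k) - \<psi> z) - 2 * U (z $ k) * V (z $ k) * (M * p (z $ k) - \<phi> z))"
      by (rule has_laplacian_multiple_minus[where \<alpha> = "\<lambda>x. (U x)\<^sup>2" and \<gamma> = "\<lambda>x. 2 * U x * V x", OF sol'(4) q_deriv q_deriv2])
    show "(U (y $ k))\<^sup>2 * (M * q (y $ k) - \<psi> y) - 2 * U (y $ k) * V (y $ k) * (M * p (y $ k) - \<phi> y)
        \<le> (U 0)\<^sup>2 * (M * q (y $ k) - \<psi> y)"
      if "- 1 * y $ k < 0" "M * q (y $ k) - \<psi> y < 0" for y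
    proof -
      have "(U 0)\<^sup>2 \<le> (U (y $ k))\<^sup>2"
        using that(1) U_mono[of 0 "y $ k"] U_pos[of 0] by (intro power_mono) auto
      then have "(U (y $ k))\<^sup>2 * (M * q (y $ k) - \<psi> y) \<le> (U 0)\<^sup>2 * (M * q (y $ k) - \<psi> y)"
        using that(2) by (intro mult_right_mono_neg) auto
      moreover have "0 \<le> 2 * U (y $ k) * V (y $ k) * (M * p (y $ k) - \<phi> y)"
        using U_pos[of "y $ k"] V_pos[of "y $ k"] p_large[of y] that(1) by (intro mult_nonneg_nonneg) auto
      ultimately show ?thesis by linarith
    qed
    show "- C \<le> M * q (y $ k) - \<psi> y" for y
    proof -
      have "0 \<le> M * q (y $ k)" using \<open>M \<ge> 0\<close> q_pos[of "y $ k"] by simp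
      then show ?thesis using C(2)[of y] by linarith
    qed
    show "0 \<le> M * q (y $ k) - \<psi> y" if "- 1 * y $ k = 0" for y
      using q_large[of y] that by simp
    show "0 < (U 0)\<^sup>2" using U_pos[of 0] by simp
  qed (use that in simp)
  then show "\<psi> z \<le> C / p 0 * q (z $ k)"
    using q_large[of z] by (cases "0 \<le> z $ k") (auto simp: M_def)
qed

section \<open>Bounded solutions do not depend on the transverse variables\<close>

text \<open>
  Both ratios \<open>\<phi> / p\<close> and \<open>\<psi> / q\<close> are compared with \<open>M (z $ e - c) / L + \<eta> \<Theta>\<close>, where
  \<open>\<Theta> = \<bar>z\<bar>\<^sup>2 + A (L\<^sup>2 - (z $ e - c)\<^sup>2)\<close>. The quadratic growth of \<open>\<Theta>\<close> makes the minimum of the two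
  differences attained, and a large constant \<open>A\<close> makes \<open>\<Theta>\<close> a strict supersolution. Finally \<open>\<eta>\<close> tends to
  \<open>0\<close> for fixed \<open>L\<close>.
\<close>

lemma slab_comparison:
  fixes \<phi> \<psi> :: "real ^ 'n::finite \<Rightarrow> real"
  assumes sol: "linearised_solution k \<phi> \<psi>" and "e \<noteq> k"
    and zero: "\<And>z. z $ e = c \<Longrightarrow> \<phi> z = 0" "\<And>z. z $ e = c \<Longrightarrow> \<psi> z = 0"
    and M: "M \<ge> 0" "\<And>z. \<phi> z \<le> M * p (z $ k)" "\<And>z. \<psi> z \<le> M * q (z $ k)"
    and "L > 0" and z: "c \<le> z $ e" "z $ e \<le> c + L"
  shows "\<phi> z \<le> M * (z $ e - c) / L * p (z $ k)" "\<psi> z \<le> M * (z $ e - c) / L * q (z $ k)"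
proof -
  have sol': "continuous_on UNIV \<phi>" "continuous_on UNIV \<psi>"
      "has_laplacian \<phi> (\<lambda>z. (V (z $ k))\<^sup>2 * \<phi> z - 2 * U (z $ k) * V (z $ k) * \<psi> z)"
      "has_laplacian \<psi> (\<lambda>z. (U (z $ k))\<^sup>2 * \<psi> z - 2 * U (z $ k) * V (z $ k) * \<phi> z)"
    using sol by (auto simp: linearised_solution_def)
  obtain K where K: "K \<ge> 0" "\<And>x. x * ((V x)\<^sup>2 * U x) \<le> K * p x"
      "\<And>x. x * - ((U x)\<^sup>2 * V x) \<le> K * q x"
    using log_derivative_bound by blast
  define N where "N = real CARD('n)"
  \<comment> \<open>The Laplacian of \<open>\<Theta>\<close> is \<open>2 N - 2 A\<close>, and the drift contributes at most \<open>4 K\<close>.\<close>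
  define A where "A = N + 2 * K + 1"
  have "A \<ge> 0" using K(1) by (simp add: A_def N_def)
  define \<Theta> where "\<Theta> = (\<lambda>z::real^'n. (norm z)\<^sup>2 + A * (L\<^sup>2 - (z $ e - c)\<^sup>2))"
  have \<Theta>: "(norm z)\<^sup>2 \<le> \<Theta> z" if "c \<le> z $ e" "z $ e \<le> c + L" for z
  proof -
    have "(z $ e - c)\<^sup>2 \<le> L\<^sup>2" using that by (intro power_mono) auto
    then show ?thesis using \<open>A \<ge> 0\<close> by (simp add: \<Theta>_def)
  qed
  have key: "\<phi> z / p (z $ k) - M * (z $ e - c) / L \<le> \<eta> * \<Theta> z \<and>
      \<psi> z / q (z $ k) - M * (z $ e - c) / L \<le> \<eta> * \<Theta> z" if "\<eta> > 0" for \<eta>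
  proof (rule ccontr)
    assume contra: "\<not> ?thesis"
    define b where "b = (\<lambda>i x. \<eta> * x\<^sup>2 + (if i = e then M * (x - c) / L + \<eta> * A * (L\<^sup>2 - (x - c)\<^sup>2) else 0))"
    define b' where "b' = (\<lambda>i x. \<eta> * (2 * x) + (if i = e then M / L + \<eta> * A * (2 * (c - x)) else 0))"
    define b'' where "b'' = (\<lambda>i (x::real). \<eta> * 2 + (if i = e then - \<eta> * A * 2 else 0))"
    define B where "B = (\<lambda>z::real^'n. \<Sum>i\<in>UNIV. b i (z $ i))"
    have b: "(b i has_real_derivative b' i x) (at x)" "(b' i has_real_derivative b'' i x) (at x)" for i x
      unfolding b_def b'_def b''_def
      by (cases "i = e"; auto intro!: derivative_eq_intros simp: \<open>L > 0\<close>[THEN less_imp_neq, symmetric] mult.commute)+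
    have B: "B z = M * (z $ e - c) / L + \<eta> * \<Theta> z" for z
      unfolding B_def b_def \<Theta>_def
      by (simp add: sum.distrib sum.delta sum_distrib_left[symmetric] sum_power2_nth algebra_simps)
    have sum_b'': "(\<Sum>i\<in>UNIV. b'' i (z $ i)) = \<eta> * (2 * N - 2 * A)" for z :: "real ^ 'n"
      unfolding b''_def by (simp add: sum.distrib sum.delta N_def algebra_simps)
    define F where "F = (\<lambda>z. B z - \<phi> z / p (z $ k))"
    define G where "G = (\<lambda>z. B z - \<psi> z / q (z $ k))"
    have ratio: "\<phi> z / p (z $ k) \<le> M" "\<psi> z / q (z $ k) \<le> M" for z
      using M(2,3)[of z] p_pos[of "z $ k"] q_pos[of "z $ k"] by (simp_all add: divide_le_eq)
    have contB: "continuous_on UNIV B"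
      unfolding B \<Theta>_def using \<open>L > 0\<close> by (intro continuous_intros) auto
    have nz: "p x \<noteq> 0" "q x \<noteq> 0" for x
      using p_pos[of x] q_pos[of x] by auto
    have contF: "continuous_on UNIV F" and contG: "continuous_on UNIV G"
      unfolding F_def G_def
      by (intro continuous_on_diff contB continuous_on_divide sol'
          continuous_on_compose2[OF continuous_on_p[of UNIV]] continuous_on_compose2[OF continuous_on_q[of UNIV]]
          continuous_intros; simp add: nz)+
    obtain z0 where z0: "z0 \<in> {z. c \<le> z $ e \<and> z $ e \<le> c + L}" "min (F z0) (G z0) < 0"
      and min: "\<And>z. z \<in> {z. c \<le> z $ e \<and> z $ e \<le> c + L} \<Longrightarrow> min (F z0) (G z0) \<le> min (F z) (G z)"
    proof (rule negative_minimum_attained[of "\<lambda>z. min (F z) (G z)" "{z. c \<le> z $ e \<and> z $ e \<le> c + L}" z "M / \<eta> + 1"])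
      show "continuous_on UNIV (\<lambda>z. min (F z) (G z))"
        by (intro continuous_intros contF contG)
      show "closed {z. c \<le> z $ e \<and> z $ e \<le> c + L}"
        by (intro closed_Collect_conj closed_Collect_le continuous_intros)
      show "min (F z) (G z) < 0"
        using contra unfolding F_def G_def B by auto
      show "0 \<le> min (F y) (G y)" if y: "y \<in> {z. c \<le> z $ e \<and> z $ e \<le> c + L}" and far: "M / \<eta> + 1 \<le> norm y" for y
      proof -
        have "0 \<le> M / \<eta>" using M(1) \<open>\<eta> > 0\<close> by simp
        then have "norm y \<le> (norm y)\<^sup>2" using far by (intro self_le_power) auto
        then have "M / \<eta> \<le> \<Theta> y" using \<Theta>[of y] far y by auto
        then have "M \<le> \<eta> * \<Theta> y" using \<open>\<eta> > 0\<close> by (simp add: divide_le_eq mult.commute)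
        moreover have "0 \<le> M * (y $ e - c) / L" using M(1) y \<open>L > 0\<close> by simp
        ultimately have "M \<le> B y" by (simp add: B)
        then show ?thesis using ratio[of y] by (simp add: F_def G_def)
      qed
    qed (use z in auto)
    have pos: "0 \<le> \<eta> * \<Theta> z0"
    proof -
      have "0 \<le> \<Theta> z0" using \<Theta>[of z0] z0(1) by (smt (verit) mem_Collect_eq zero_le_power2)
      then show ?thesis using \<open>\<eta> > 0\<close> by simp
    qed
    \<comment> \<open>On both faces of the slab the differences are nonnegative: on \<open>z $ e = c\<close> because the solution
       vanishes, on \<open>z $ e = c + L\<close> because the ratios are at most \<open>M\<close>.\<close>
    have "z0 $ e \<noteq> c"
      using z0(2) zero[of z0] pos by (auto simp: F_def G_def B)
    moreover have "z0 $ e \<noteq> c + L"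
      using z0(2) ratio[of z0] pos \<open>L > 0\<close> by (auto simp: F_def G_def B)
    ultimately have inside: "z0 \<in> {z. c < z $ e \<and> z $ e < c + L}" using z0(1) by auto
    have op: "open {z::real^'n. c < z $ e \<and> z $ e < c + L}"
      by (intro open_Collect_conj open_Collect_less continuous_intros)
    have b'k: "b' k x = 2 * \<eta> * x" for x
      using \<open>e \<noteq> k\<close> by (simp add: b'_def)
    have strict: "2 * r * (2 * \<eta> * x) + s * (\<eta> * (2 * N - 2 * A)) < 0"
      if "x * r \<le> K * s" "s > 0" for r s x
    proof -
      have "2 * r * (2 * \<eta> * x) + s * (\<eta> * (2 * N - 2 * A))
          = 4 * \<eta> * (x * r - K * s) - 2 * \<eta> * s"
        by (simp add: A_def algebra_simps)
      also have "\<dots> < 0"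
      proof -
        have "4 * \<eta> * (x * r - K * s) \<le> 0" using that(1) \<open>\<eta> > 0\<close> by (intro mult_nonneg_nonpos) auto
        moreover have "0 < 2 * \<eta> * s" using that(2) \<open>\<eta> > 0\<close> by simp
        ultimately show ?thesis by linarith
      qed
      finally show ?thesis .
    qed
    consider "F z0 \<le> G z0" | "G z0 \<le> F z0" by linarith
    then show False
    proof cases
      case 1
      have "0 \<le> 2 * ((V (z0 $ k))\<^sup>2 * U (z0 $ k)) * b' k (z0 $ k) + p (z0 $ k) * (\<Sum>i\<in>UNIV. b'' i (z0 $ i))"
      proof (rule ratio_touching[where \<alpha> = "\<lambda>x. (V x)\<^sup>2" and \<gamma> = "\<lambda>x. 2 * U x * V x" and v = \<psi>
            and d = q and w = \<phi>, OF p_deriv p_deriv2 _ p_pos q_pos _ sol'(3) b op inside])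
        show "0 \<le> 2 * U x * V x" for x using U_pos[of x] V_pos[of x] by simp
        show "(\<Sum>i\<in>UNIV. b i (z0 $ i)) - \<phi> z0 / p (z0 $ k) \<le> (\<Sum>i\<in>UNIV. b i (y $ i)) - \<phi> y / p (y $ k)"
          if "y \<in> {z. c < z $ e \<and> z $ e < c + L}" for y
          using min[of y] that 1 by (simp add: F_def B_def min_def split: if_splits)
        show "(\<Sum>i\<in>UNIV. b i (z0 $ i)) - \<phi> z0 / p (z0 $ k) \<le> (\<Sum>i\<in>UNIV. b i (z0 $ i)) - \<psi> z0 / q (z0 $ k)"
          using 1 by (simp add: F_def G_def B_def)
      qed simp
      then show False
        using strict[OF K(2) p_pos, of "z0 $ k"] unfolding b'k sum_b'' by linarith
    next
      case 2
      have "0 \<le> 2 * - ((U (z0 $ k))\<^sup>2 * V (z0 $ k)) * b' k (z0 $ k) + q (z0 $ k) * (\<Sum>i\<in>UNIV. b'' i (z0 $ i))"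
      proof (rule ratio_touching[where \<alpha> = "\<lambda>x. (U x)\<^sup>2" and \<gamma> = "\<lambda>x. 2 * U x * V x" and v = \<phi>
            and d = p and w = \<psi>, OF q_deriv q_deriv2 _ q_pos p_pos _ sol'(4) b op inside])
        show "0 \<le> 2 * U x * V x" for x using U_pos[of x] V_pos[of x] by simp
        show "(\<Sum>i\<in>UNIV. b i (z0 $ i)) - \<psi> z0 / q (z0 $ k) \<le> (\<Sum>i\<in>UNIV. b i (y $ i)) - \<psi> y / q (y $ k)"
          if "y \<in> {z. c < z $ e \<and> z $ e < c + L}" for y
          using min[of y] that 2 by (simp add: G_def B_def min_def split: if_splits)
        show "(\<Sum>i\<in>UNIV. b i (z0 $ i)) - \<psi> z0 / q (z0 $ k) \<le> (\<Sum>i\<in>UNIV. b i (z0 $ i)) - \<phi> z0 / p (z0 $ k)"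
          using 2 by (simp add: F_def G_def B_def)
      qed simp
      then show False
        using strict[OF K(3) q_pos, of "z0 $ k"] unfolding b'k sum_b'' by linarith
    qed
  qed
  have "\<phi> z / p (z $ k) - M * (z $ e - c) / L \<le> 0" "\<psi> z / q (z $ k) - M * (z $ e - c) / L \<le> 0"
    by (rule nonpos_if_le_small_multiples[of _ "\<Theta> z"]; use key in blast)+
  then show "\<phi> z \<le> M * (z $ e - c) / L * p (z $ k)" "\<psi> z \<le> M * (z $ e - c) / L * q (z $ k)"
    using p_pos[of "z $ k"] q_pos[of "z $ k"] by (simp_all add: divide_le_eq)
qed

text \<open>
  A Phragmen-Lindeloef principle: the bound on the slab of width \<open>L\<close> tends to \<open>0\<close> as \<open>L\<close> tends to
  infinity. In the proof \<open>\<eta>\<close> stands for \<open>1 / L\<close>.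
\<close>

lemma solution_nonpos_on_halfspace:
  fixes \<phi> \<psi> :: "real ^ 'n::finite \<Rightarrow> real"
  assumes sol: "linearised_solution k \<phi> \<psi>" and "e \<noteq> k"
    and zero: "\<And>z. z $ e = c \<Longrightarrow> \<phi> z = 0" "\<And>z. z $ e = c \<Longrightarrow> \<psi> z = 0"
    and C: "\<And>z. \<bar>\<phi> z\<bar> \<le> C" "\<And>z. \<bar>\<psi> z\<bar> \<le> C"
    and z: "c \<le> z $ e"
  shows "\<phi> z \<le> 0" "\<psi> z \<le> 0"
proof -
  define M where "M = C / p 0"
  have "C \<ge> 0" using C(1)[of 0] by linarith
  then have M: "M \<ge> 0" using p_pos[of 0] by (simp add: M_def)
  have small: "\<phi> z \<le> \<eta> * (M * (z $ e - c) * p (z $ k)) \<and> \<psi> z \<le> \<eta> * (M * (z $ e - c) * q (z $ k))"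
    if "\<eta> > 0" "\<eta> * (z $ e - c) \<le> 1" for \<eta>
    using slab_comparison[OF sol \<open>e \<noteq> k\<close> zero M bounded_solution_le_profile[OF sol C, folded M_def], where L = "1 / \<eta>" and z = z and c = c]
      that z by (simp add: field_simps)
  define T where "T = z $ e - c + 1"
  have "T \<ge> 1" using z by (simp add: T_def)
  have less: "x \<le> 0" if "\<And>\<eta>. \<eta> > 0 \<Longrightarrow> \<eta> * (z $ e - c) \<le> 1 \<Longrightarrow> x \<le> \<eta> * W" "W \<ge> 0" for x W :: real
  proof (rule nonpos_if_le_small_multiples)
    fix \<eta> :: real assume "\<eta> > 0"
    define \<eta>' where "\<eta>' = min \<eta> (1 / T)"
    have "\<eta>' > 0" using \<open>\<eta> > 0\<close> \<open>T \<ge> 1\<close> by (simp add: \<eta>'_def)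
    moreover have "\<eta>' * (z $ e - c) \<le> 1 / T * T"
      using z \<open>T \<ge> 1\<close> \<open>\<eta>' > 0\<close> by (intro mult_mono) (auto simp: \<eta>'_def T_def)
    ultimately have "x \<le> \<eta>' * W" using that(1) \<open>T \<ge> 1\<close> by simp
    also have "\<dots> \<le> \<eta> * W" using that(2) by (intro mult_right_mono) (auto simp: \<eta>'_def)
    finally show "x \<le> \<eta> * W" .
  qed
  show "\<phi> z \<le> 0"
    by (rule less[of _ "M * (z $ e - c) * p (z $ k)"]) (use small M z p_pos[of "z $ k"] in auto)
  show "\<psi> z \<le> 0"
    by (rule less[of _ "M * (z $ e - c) * q (z $ k)"]) (use small M z q_pos[of "z $ k"] in auto)
qed

text \<open>
  The half-space principle applies to the difference of the solution and its reflection, and to the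
  negative of this difference.
\<close>

lemma bounded_solution_reflection_symmetric:
  fixes \<phi> \<psi> :: "real ^ 'n::finite \<Rightarrow> real"
  assumes sol: "linearised_solution k \<phi> \<psi>" and "e \<noteq> k"
    and C: "\<And>z. \<bar>\<phi> z\<bar> \<le> C" "\<And>z. \<bar>\<psi> z\<bar> \<le> C"
    and z: "c \<le> z $ e"
  shows "\<phi> (reflect e c z) = \<phi> z" "\<psi> (reflect e c z) = \<psi> z"
proof -
  define w where "w = (\<lambda>z. \<phi> z - \<phi> (reflect e c z))"
  define v where "v = (\<lambda>z. \<psi> z - \<psi> (reflect e c z))"
  have fixed: "reflect e c y = y" if "y $ e = c" for y
    using that by (simp add: reflect_def vec_eq_iff)
  have sol': "linearised_solution k w v"
    unfolding w_def v_def by (rule linearised_solution_diff_reflect[OF sol \<open>e \<noteq> k\<close>])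
  have bd: "\<bar>w y\<bar> \<le> 2 * C" "\<bar>v y\<bar> \<le> 2 * C" for y
    using C(1)[of y] C(1)[of "reflect e c y"] C(2)[of y] C(2)[of "reflect e c y"]
    by (simp_all add: w_def v_def)
  have le: "w z \<le> 0" "v z \<le> 0"
    by (rule solution_nonpos_on_halfspace[OF sol' \<open>e \<noteq> k\<close> _ _ bd z]; simp add: w_def v_def fixed)+
  have "\<bar>- w y\<bar> \<le> 2 * C" "\<bar>- v y\<bar> \<le> 2 * C" for y
    using bd[of y] by simp_all
  note bd' = this
  have "- w z \<le> 0" "- v z \<le> 0"
    by (rule solution_nonpos_on_halfspace[OF linearised_solution_minus[OF sol'] \<open>e \<noteq> k\<close> _ _ bd' z];
        simp add: w_def v_def fixed)+
  with le show "\<phi> (reflect e c z) = \<phi> z" "\<psi> (reflect e c z) = \<psi> z"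
    by (simp_all add: w_def v_def)
qed

section \<open>The one-dimensional problem and the classification\<close>

text \<open>
  A positive value of \<open>E\<close> would persist to the right and give \<open>H\<close> at least linear growth.
\<close>

lemma nonpos_if_le_derivative_of_bounded:
  fixes E H :: "real \<Rightarrow> real"
  assumes mono: "\<And>x y. x \<le> y \<Longrightarrow> E x \<le> E y"
    and H: "\<And>x. (H has_real_derivative H' x) (at x)" "\<And>x. E x \<le> H' x" "\<And>x. \<bar>H x\<bar> \<le> K"
  shows "E x \<le> 0"
proof (rule ccontr)
  assume E: "\<not> E x \<le> 0"
  define y where "y = x + (2 * K + 1) / E x"
  have "K \<ge> 0" using H(3)[of 0] by linarith
  then have "x \<le> y" using E by (simp add: y_def)
  have "H x - E x * x \<le> H y - E x * y"
  proof (rule DERIV_nonneg_imp_nondecreasing[OF \<open>x \<le> y\<close>, of "\<lambda>s. H s - E x * s"])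
    fix s assume "x \<le> s"
    then show "\<exists>d. ((\<lambda>s. H s - E x * s) has_real_derivative d) (at s) \<and> 0 \<le> d"
      using mono[of x s] H(2)[of s]
      by (intro exI[of _ "H' s - E x"]) (auto intro!: derivative_eq_intros H(1))
  qed
  then have "E x * (y - x) \<le> H y - H x" by (simp add: algebra_simps)
  moreover have "E x * (y - x) = 2 * K + 1" using E by (simp add: y_def)
  ultimately show False using H(3)[of x] H(3)[of y] by linarith
qed

text \<open>
  The set where a continuous function exceeds its essential bound is open and negligible, hence empty.
\<close>

lemma L_infty_continuous_bounded:
  assumes "L_infty f" "continuous_on UNIV f"
  obtains C where "\<And>z. \<bar>f z\<bar> \<le> C"
proof -
  from assms(1) obtain C where "AE z in lebesgue. \<bar>f z\<bar> \<le> C"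
    unfolding L_infty_def by blast
  moreover have op: "open {z. C < \<bar>f z\<bar>}"
    using assms(2) by (intro open_Collect_less continuous_intros)
  ultimately have "negligible {z. C < \<bar>f z\<bar>}"
    by (simp add: negligible_iff_null_sets AE_iff_null_sets not_less lborelD)
  then have "{z. C < \<bar>f z\<bar>} = {}"
    using open_not_negligible[OF op] by blast
  then show ?thesis using that[of C] by (force simp: not_le[symmetric])
qed

text \<open>
  The Wronskians \<open>A = p\<^sup>2 (f / p)'\<close> and \<open>B = q\<^sup>2 (g / q)'\<close> satisfy \<open>A' = 2 U V D\<close> and \<open>B' = - 2 U V D\<close> with
  \<open>D = f q - g p\<close>. Hence the derivative of \<open>E = (f / p) A + (g / q) B\<close> is a sum of three nonnegative terms.
  Both signs of \<open>E\<close> are excluded by \<open>nonpos_if_le_derivative_of_bounded\<close>: of the two terms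
  \<open>- (f / p)\<^sup>2 p p'\<close> and \<open>- (g / q)\<^sup>2 q q'\<close> of \<open>E\<close>, one can be dropped by its sign, and the other is
  estimated by replacing the square of the ratio with \<open>M\<^sup>2\<close>. In this way \<open>E\<close> lies between the derivatives
  of \<open>(f\<^sup>2 + g\<^sup>2 - M\<^sup>2 p\<^sup>2) / 2\<close> and \<open>(f\<^sup>2 + g\<^sup>2 - M\<^sup>2 q\<^sup>2) / 2\<close>.
\<close>

lemma one_dimensional_solution_unique:
  assumes f: "\<And>x. (f has_real_derivative f' x) (at x)"
      "\<And>x. (f' has_real_derivative (V x)\<^sup>2 * f x - 2 * U x * V x * g x) (at x)"
    and g: "\<And>x. (g has_real_derivative g' x) (at x)"
      "\<And>x. (g' has_real_derivative (U x)\<^sup>2 * g x - 2 * U x * V x * f x) (at x)"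
    and M: "\<And>x. \<bar>f x\<bar> \<le> M * p x" "\<And>x. \<bar>g x\<bar> \<le> M * q x"
  obtains a where "\<And>x. f x = a * p x" "\<And>x. g x = a * q x"
proof -
  define p1 where "p1 = (\<lambda>x. (V x)\<^sup>2 * U x)"
  define q1 where "q1 = (\<lambda>x. - ((U x)\<^sup>2 * V x))"
  have pq: "p x \<noteq> 0" "q x \<noteq> 0" for x
    using p_pos[of x] q_pos[of x] by auto
  have sign: "0 \<le> p x * p1 x" "q x * q1 x \<le> 0" for x
    using p_pos[of x] q_pos[of x] U_pos[of x] V_pos[of x] by (simp_all add: p1_def q1_def mult_le_0_iff)
  define D where "D = (\<lambda>x. f x * q x - g x * p x)"
  define A where "A = (\<lambda>x. f' x * p x - f x * p1 x)"
  define B where "B = (\<lambda>x. g' x * q x - g x * q1 x)"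
  define r where "r = (\<lambda>x. f x / p x)"
  define s where "s = (\<lambda>x. g x / q x)"
  define E where "E = (\<lambda>x. r x * A x + s x * B x)"
  define E1 where "E1 = (\<lambda>x. (A x / p x)\<^sup>2 + (B x / q x)\<^sup>2 + 2 * U x * V x * (D x)\<^sup>2 / (p x * q x))"
  have dA: "(A has_real_derivative 2 * U x * V x * D x) (at x)" for x
    unfolding A_def D_def p1_def
    by (rule DERIV_cong, rule DERIV_diff[OF DERIV_mult[OF f(2) p_deriv] DERIV_mult[OF f(1) p_deriv2]])
       (simp add: algebra_simps)
  have dB: "(B has_real_derivative - 2 * U x * V x * D x) (at x)" for x
    unfolding B_def D_def q1_def
    by (rule DERIV_cong, rule DERIV_diff[OF DERIV_mult[OF g(2) q_deriv] DERIV_mult[OF g(1) q_deriv2]])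
       (simp add: algebra_simps)
  have dr: "(r has_real_derivative A x / (p x)\<^sup>2) (at x)" for x
    unfolding r_def A_def p1_def
    by (rule DERIV_cong, rule DERIV_divide[OF f(1) p_deriv pq(1)])
       (simp add: power2_eq_square)
  have ds: "(s has_real_derivative B x / (q x)\<^sup>2) (at x)" for x
    unfolding s_def B_def q1_def
    by (rule DERIV_cong, rule DERIV_divide[OF g(1) q_deriv pq(2)])
       (simp add: power2_eq_square)
  have dE: "(E has_real_derivative E1 x) (at x)" for x
  proof -
    have rs: "r x - s x = D x / (p x * q x)"
      using pq[of x] by (simp add: r_def s_def D_def field_simps)
    have "A x / (p x)\<^sup>2 * A x + 2 * U x * V x * D x * r x
        + (B x / (q x)\<^sup>2 * B x + - 2 * U x * V x * D x * s x)
        = (A x / p x)\<^sup>2 + (B x / q x)\<^sup>2 + 2 * U x * V x * D x * (r x - s x)"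
      by (simp add: power2_eq_square algebra_simps)
    also have "\<dots> = E1 x"
      unfolding rs E1_def by (simp add: power2_eq_square)
    finally show ?thesis
      unfolding E_def by (rule DERIV_cong[OF DERIV_add[OF DERIV_mult[OF dr dA] DERIV_mult[OF ds dB]]])
  qed
  have E1_terms: "0 \<le> (A x / p x)\<^sup>2" "0 \<le> (B x / q x)\<^sup>2" "0 \<le> 2 * U x * V x * (D x)\<^sup>2 / (p x * q x)" for x
    using U_pos[of x] V_pos[of x] p_pos[of x] q_pos[of x] by simp_all
  have E_mono: "E x \<le> E y" if "x \<le> y" for x y
  proof (rule DERIV_nonneg_imp_nondecreasing[OF that])
    show "\<exists>d. (E has_real_derivative d) (at t) \<and> 0 \<le> d" for t
      using dE[of t] E1_terms[of t] by (intro exI[of _ "E1 t"]) (simp add: E1_def)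
  qed
  have E_alt: "E x = f x * f' x + g x * g' x - (r x)\<^sup>2 * (p x * p1 x) - (s x)\<^sup>2 * (q x * q1 x)" for x
  proof -
    have "f x = r x * p x" "g x = s x * q x"
      using pq[of x] by (simp_all add: r_def s_def)
    then show ?thesis
      by (simp add: E_def A_def B_def power2_eq_square algebra_simps)
  qed
  have "M \<ge> 0" using M(1)[of 0] p_pos[of 0] by (smt (verit) mult_neg_pos)
  have r2: "(r x)\<^sup>2 \<le> M\<^sup>2" and s2: "(s x)\<^sup>2 \<le> M\<^sup>2" for x
  proof -
    have "\<bar>r x\<bar> \<le> M" "\<bar>s x\<bar> \<le> M"
      using M[of x] p_pos[of x] q_pos[of x] by (simp_all add: r_def s_def divide_le_eq)
    then show "(r x)\<^sup>2 \<le> M\<^sup>2" "(s x)\<^sup>2 \<le> M\<^sup>2"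
      using \<open>M \<ge> 0\<close> by (simp_all add: abs_le_square_iff[symmetric])
  qed
  have sq: "(p x)\<^sup>2 \<le> 1" "(q x)\<^sup>2 \<le> 1" "(f x)\<^sup>2 \<le> M\<^sup>2" "(g x)\<^sup>2 \<le> M\<^sup>2" for x
  proof -
    show p1: "(p x)\<^sup>2 \<le> 1" and q1: "(q x)\<^sup>2 \<le> 1"
      using p_le_1[of x] q_le_1[of x] p_pos[of x] q_pos[of x] by (simp_all add: power_le_one)
    have "(f x)\<^sup>2 = (r x)\<^sup>2 * (p x)\<^sup>2" "(g x)\<^sup>2 = (s x)\<^sup>2 * (q x)\<^sup>2"
      using pq[of x] by (simp_all add: r_def s_def power_divide)
    then show "(f x)\<^sup>2 \<le> M\<^sup>2" "(g x)\<^sup>2 \<le> M\<^sup>2"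
      using mult_mono[OF r2[of x] p1] mult_mono[OF s2[of x] q1] by simp_all
  qed
  define H where "H = (\<lambda>h x. ((f x)\<^sup>2 + (g x)\<^sup>2 - M\<^sup>2 * (h x)\<^sup>2) / 2)"
  have average: "\<bar>(a + b - c) / 2\<bar> \<le> m"
    if "0 \<le> a" "a \<le> m" "0 \<le> b" "b \<le> m" "0 \<le> c" "c \<le> m" for a b c m :: real
    using that by (simp add: abs_le_iff)
  have H_bound: "\<bar>H h x\<bar> \<le> M\<^sup>2" if "(h x)\<^sup>2 \<le> 1" for h x
    unfolding H_def
    by (rule average) (use that sq(3,4)[of x] in \<open>simp_all add: mult_left_le\<close>)
  have dH: "(H h has_real_derivative f x * f' x + g x * g' x - M\<^sup>2 * (h x * h')) (at x)"
    if h: "(h has_real_derivative h') (at x)" for h h' x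
  proof -
    have square: "((\<lambda>x. (u x)\<^sup>2) has_real_derivative 2 * (u x * u')) (at x)"
      if "(u has_real_derivative u') (at x)" for u u'
      using DERIV_power[OF that, of 2] by (simp add: mult.commute)
    have "(H h has_real_derivative (2 * (f x * f' x) + 2 * (g x * g' x) - M\<^sup>2 * (2 * (h x * h'))) / 2) (at x)"
      unfolding H_def
      by (intro DERIV_cdivide DERIV_diff DERIV_add DERIV_cmult square f(1) g(1) h)
    then show ?thesis by (rule DERIV_cong) (simp add: diff_divide_distrib add_divide_distrib)
  qed
  have "E x \<le> 0" for x
  proof (rule nonpos_if_le_derivative_of_bounded[OF E_mono])
    show "(H q has_real_derivative f x * f' x + g x * g' x - M\<^sup>2 * (q x * q1 x)) (at x)" for x
      unfolding q1_def by (rule dH[OF q_deriv])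
    show "E x \<le> f x * f' x + g x * g' x - M\<^sup>2 * (q x * q1 x)" for x
      using mult_right_mono_neg[OF s2[of x] sign(2)[of x]] mult_nonneg_nonneg[OF _ sign(1)[of x], of "(r x)\<^sup>2"]
      unfolding E_alt by simp
    show "\<bar>H q x\<bar> \<le> M\<^sup>2" for x by (rule H_bound) (rule sq(2))
  qed
  \<comment> \<open>The reversal \<open>x \<mapsto> - x\<close> turns the lower bound at \<open>- \<infinity>\<close> into an upper bound at \<open>+ \<infinity>\<close>.\<close>
  moreover have "- E (- x) \<le> 0" for x
  proof (rule nonpos_if_le_derivative_of_bounded[of "\<lambda>x. - E (- x)"])
    show "- E (- x) \<le> - E (- y)" if "x \<le> y" for x y using E_mono[of "- y" "- x"] that by simp
    show "((\<lambda>x. H p (- x)) has_real_derivative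
        - (f (- x) * f' (- x) + g (- x) * g' (- x) - M\<^sup>2 * (p (- x) * p1 (- x)))) (at x)" for x
      using dH[OF p_deriv, of "- x"] DERIV_mirror[of "H p" _ x] unfolding p1_def by blast
    show "- E (- x) \<le> - (f (- x) * f' (- x) + g (- x) * g' (- x) - M\<^sup>2 * (p (- x) * p1 (- x)))" for x
      using mult_right_mono[OF r2[of "- x"] sign(1)[of "- x"]] mult_nonneg_nonpos[OF _ sign(2)[of "- x"], of "(s (- x))\<^sup>2"]
      unfolding E_alt by simp
    show "\<bar>H p (- x)\<bar> \<le> M\<^sup>2" for x by (rule H_bound) (rule sq(1))
  qed
  then have "0 \<le> E x" for x by (metis add.inverse_inverse neg_le_0_iff_le)
  ultimately have "E = (\<lambda>x. 0)" by (intro ext antisym)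
  then have "E1 x = 0" for x
    using DERIV_unique[OF dE[of x]] by simp
  then have A2: "(A x / p x)\<^sup>2 = 0" and D2: "2 * U x * V x * (D x)\<^sup>2 / (p x * q x) = 0" for x
    using E1_terms[of x] unfolding E1_def by (smt (verit))+
  have "A x = 0" for x using A2[of x] pq(1)[of x] by simp
  then have "r x = r 0" for x
    using dr by (intro DERIV_isconst_all) simp
  then have fr: "f x = r 0 * p x" for x
    using pq(1)[of x] by (metis nonzero_eq_divide_eq r_def)
  have gr: "g x = r 0 * q x" for x
  proof -
    have "D x = 0"
      using D2[of x] pq[of x] U_pos[of x] V_pos[of x] by simp
    then have "g x * p x = (r 0 * q x) * p x"
      by (auto simp: D_def fr)
    then show ?thesis
      using pq(1)[of x] by simp
  qed
  show ?thesis by (rule that[OF fr gr])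
qed

theorem bounded_solution_classification:
  fixes \<phi> \<psi> :: "real ^ 'n::finite \<Rightarrow> real"
  assumes sol: "linearised_solution k \<phi> \<psi>"
    and C: "\<And>z. \<bar>\<phi> z\<bar> \<le> C" "\<And>z. \<bar>\<psi> z\<bar> \<le> C"
  obtains a where "\<And>z. \<phi> z = a * p (z $ k)" "\<And>z. \<psi> z = a * q (z $ k)"
proof -
  have dep: "\<phi> z = \<phi> w" "\<psi> z = \<psi> w" if "z $ k = w $ k" for z w
    by (rule depends_on_one_coordinate_if_reflection_symmetric[OF bounded_solution_reflection_symmetric(1)[OF sol _ C] that]
          depends_on_one_coordinate_if_reflection_symmetric[OF bounded_solution_reflection_symmetric(2)[OF sol _ C] that];
        assumption)+
  have k: "(x *\<^sub>R axis k 1 :: real ^ 'n) $ k = x" for x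
    by (simp add: axis_def)
  obtain f' where f:
    "\<And>x. ((\<lambda>x. \<phi> (x *\<^sub>R axis k 1)) has_real_derivative f' x) (at x)"
    "\<And>x. (f' has_real_derivative (V x)\<^sup>2 * \<phi> (x *\<^sub>R axis k 1) - 2 * U x * V x * \<psi> (x *\<^sub>R axis k 1)) (at x)"
  proof (rule has_laplacian_one_variable[where k = k])
    show "has_laplacian \<phi> (\<lambda>z. (V (z $ k))\<^sup>2 * \<phi> z - 2 * U (z $ k) * V (z $ k) * \<psi> z)"
      using sol by (simp add: linearised_solution_def)
  qed (erule dep(1), unfold k, blast)
  obtain g' where g:
    "\<And>x. ((\<lambda>x. \<psi> (x *\<^sub>R axis k 1)) has_real_derivative g' x) (at x)"
    "\<And>x. (g' has_real_derivative (U x)\<^sup>2 * \<psi> (x *\<^sub>R axis k 1) - 2 * U x * V x * \<phi> (x *\<^sub>R axis k 1)) (at x)"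
  proof (rule has_laplacian_one_variable[where k = k])
    show "has_laplacian \<psi> (\<lambda>z. (U (z $ k))\<^sup>2 * \<psi> z - 2 * U (z $ k) * V (z $ k) * \<phi> z)"
      using sol by (simp add: linearised_solution_def)
  qed (erule dep(2), unfold k, blast)
  have C': "\<bar>- \<phi> z\<bar> \<le> C" "\<bar>- \<psi> z\<bar> \<le> C" for z using C[of z] by simp_all
  have M: "\<bar>\<phi> (x *\<^sub>R axis k 1)\<bar> \<le> C / p 0 * p x" "\<bar>\<psi> (x *\<^sub>R axis k 1)\<bar> \<le> C / p 0 * q x" for x
    using bounded_solution_le_profile[OF sol C, of "x *\<^sub>R axis k 1"]
      bounded_solution_le_profile[OF linearised_solution_minus[OF sol] C', of "x *\<^sub>R axis k 1"]
    unfolding k by linarith+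
  obtain a where a: "\<And>x. \<phi> (x *\<^sub>R axis k 1) = a * p x" "\<And>x. \<psi> (x *\<^sub>R axis k 1) = a * q x"
    using one_dimensional_solution_unique[OF f g M] by blast
  have "\<phi> z = a * p (z $ k)" "\<psi> z = a * q (z $ k)" for z
    using dep[of z "(z $ k) *\<^sub>R axis k 1"] a[of "z $ k"] by (simp_all add: k)
  then show ?thesis by (rule that)
qed

end

(* A point z of R^N is (x, y) with x = z $ k for a distinguished coordinate k and y the
   remaining N - 1 coordinates, where N = CARD('n) >= 1 (there are none for N = 1). *)
theorem theorem1:
  fixes U V :: "real \<Rightarrow> real"
    and P Q :: "real ^ 'n::finite \<Rightarrow> real"
    and k :: 'n
  assumes "profile U V"
    and "C_k 2 P" and "L_infty P"
    and "C_k 2 Q" and "L_infty Q"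
    and "\<And>z. - laplacian P z + (V (z $ k))\<^sup>2 * P z + 2 * U (z $ k) * V (z $ k) * Q z = 0"
    and "\<And>z. - laplacian Q z + (U (z $ k))\<^sup>2 * Q z + 2 * U (z $ k) * V (z $ k) * P z = 0"
  shows "(\<forall>z w. z $ k = w $ k \<longrightarrow> P z = P w \<and> Q z = Q w) \<and>
         (\<exists>a. \<forall>z. P z = a * deriv U (z $ k) \<and> Q z = a * deriv V (z $ k))"
proof -
  interpret reflected_profile U V by unfold_locales (rule assms(1))
  have cont: "continuous_on UNIV P" "continuous_on UNIV Q"
    using assms(2,4) by (simp_all add: numeral_2_eq_2)
  have "laplacian P = (\<lambda>z. (V (z $ k))\<^sup>2 * P z - 2 * U (z $ k) * V (z $ k) * - Q z)"
    using assms(6) by (auto simp: algebra_simps)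
  moreover have "(\<lambda>z. - laplacian Q z) = (\<lambda>z. (U (z $ k))\<^sup>2 * - Q z - 2 * U (z $ k) * V (z $ k) * P z)"
  proof
    show "- laplacian Q z = (U (z $ k))\<^sup>2 * - Q z - 2 * U (z $ k) * V (z $ k) * P z" for z
      using assms(7)[of z] by (simp add: algebra_simps)
  qed
  ultimately have sol: "linearised_solution k P (\<lambda>z. - Q z)"
    using cont C_k_2_has_laplacian[OF assms(2)] has_laplacian_minus[OF C_k_2_has_laplacian[OF assms(4)]]
    unfolding linearised_solution_def by (auto intro: continuous_on_minus)
  obtain C1 where C1: "\<And>z. \<bar>P z\<bar> \<le> C1"
    using L_infty_continuous_bounded[OF assms(3) cont(1)] by blast
  obtain C2 where C2: "\<And>z. \<bar>Q z\<bar> \<le> C2"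
    using L_infty_continuous_bounded[OF assms(5) cont(2)] by blast
  obtain a where a: "\<And>z. P z = a * p (z $ k)" "\<And>z. - Q z = a * q (z $ k)"
  proof (rule bounded_solution_classification[OF sol])
    show "\<bar>P z\<bar> \<le> max C1 C2" "\<bar>- Q z\<bar> \<le> max C1 C2" for z
      using C1[of z] C2[of z] by simp_all
  qed blast
  have "P z = a * deriv U (z $ k)" "Q z = a * deriv V (z $ k)" for z
    using a(1)[of z] a(2)[of z] by (simp_all add: p_def q_def)
  then show ?thesis by auto
qed

end
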